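(* Let $G$ be a graph on vertex set $[n]$ with adjacency matrix $A$, let $q\in(0,1)$, let $J$ be the $n\times n$ all-ones matrix and $B=A-qJ$. For fixed $i,j\in[n]$ and any integer $r<O(\log n)$, there is an algorithm (subroutine \textsc{ComputeNorm}$(B,i,j,r)$) in the $s$-space MPC model, where each machine has memory $s=\Omega(\log n)$, that computes $\|B^r_i-B^r_j\|$ in $O(r\log_s n)$ rounds.
   Context: $B^r_i$ denotes the $i$-th row of the matrix $B^r$ and $\|\cdot\|$ the Euclidean norm. The $s$-space MPC model: the input edges are arbitrarily distributed among machines, each having local memory of $s$ words of $O(\log n)$ bits; machines communicate in synchronous rounds, local computation is free, and the round complexity is the number of communication rounds. *)

theory Defs
  imports Complex_Main "Jordan_Normal_Form.Matrix"
begin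

section \<open>Graphs and matrices\<close>

text \<open>The vertex set \<open>[n]\<close> is \<open>{..<n}\<close>; edges are two-element sets of vertices.\<close>

definition graph_on :: "nat \<Rightarrow> nat set set \<Rightarrow> bool" where
  "graph_on n E \<longleftrightarrow> E \<subseteq> {{u, v} | u v. u < n \<and> v < n \<and> u \<noteq> v}"

definition adjacency :: "nat \<Rightarrow> nat set set \<Rightarrow> real mat" where
  "adjacency n E = mat n n (\<lambda>(u, v). if {u, v} \<in> E then 1 else 0)"

definition all_ones :: "nat \<Rightarrow> real mat" where
  "all_ones n = mat n n (\<lambda>_. 1)"

definition shifted_adjacency :: "nat \<Rightarrow> nat set set \<Rightarrow> real \<Rightarrow> real mat" where
  "shifted_adjacency n E q = adjacency n E - q \<cdot>\<^sub>m all_ones n"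

definition euclidean_norm :: "real vec \<Rightarrow> real" where
  "euclidean_norm v = sqrt (v \<bullet> v)"


section \<open>Massively parallel computation\<close>

text \<open>
  There are \<open>N\<close> machines, named \<open>0, \<dots>, N - 1\<close>. A word is a natural number below the same
  bound \<open>N\<close>, so that machine names are words. With \<open>N = n ^ W\<close> a word has \<open>W log n\<close> bits.

  Local computation is free, so an algorithm consists of arbitrary functions:
  \<^item> \<open>message t k m l\<close> is the message (empty if nothing is sent) from machine \<open>k\<close> with memory
    contents \<open>m\<close> to machine \<open>l\<close> in round \<open>t\<close>;
  \<^item> \<open>update t k m inbox\<close> is the new memory of \<open>k\<close> once it has received \<open>inbox l\<close> from each \<open>l\<close>;
  \<^item> \<open>emit t m\<close> is what the output machine \<open>0\<close> writes at the end of round \<open>t\<close>, with memory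
    contents \<open>m\<close>, to its write-only output;
  \<^item> \<open>decode\<close> gives the real number that the written words represent.

  The functions see neither the graph nor how its edges are distributed, except through the
  memory contents.
\<close>

record mpc_algorithm =
  rounds :: nat
  message :: "nat \<Rightarrow> nat \<Rightarrow> nat list \<Rightarrow> nat \<Rightarrow> nat list"
  update :: "nat \<Rightarrow> nat \<Rightarrow> nat list \<Rightarrow> (nat \<Rightarrow> nat list) \<Rightarrow> nat list"
  emit :: "nat \<Rightarrow> nat list \<Rightarrow> nat list"
  decode :: "nat list \<Rightarrow> real"

text \<open>\<open>memory \<A> N input t k\<close> is the memory of machine \<open>k\<close> after \<open>t\<close> rounds.\<close>

primrec memory :: "mpc_algorithm \<Rightarrow> nat \<Rightarrow> (nat \<Rightarrow> nat list) \<Rightarrow> nat \<Rightarrow> nat \<Rightarrow> nat list" where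
  "memory \<A> N input 0 = input"
| "memory \<A> N input (Suc t) = (\<lambda>k. update \<A> t k (memory \<A> N input t k)
     (\<lambda>l. if l < N then message \<A> t l (memory \<A> N input t l) k else []))"

definition sent :: "mpc_algorithm \<Rightarrow> nat \<Rightarrow> (nat \<Rightarrow> nat list) \<Rightarrow> nat \<Rightarrow> nat \<Rightarrow> nat \<Rightarrow> nat list" where
  "sent \<A> N input t k l = message \<A> t k (memory \<A> N input t k) l"

definition written :: "mpc_algorithm \<Rightarrow> nat \<Rightarrow> (nat \<Rightarrow> nat list) \<Rightarrow> nat \<Rightarrow> nat list" where
  "written \<A> N input t = emit \<A> t (memory \<A> N input (Suc t) 0)"

definition mpc_output :: "mpc_algorithm \<Rightarrow> nat \<Rightarrow> (nat \<Rightarrow> nat list) \<Rightarrow> nat list" where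
  "mpc_output \<A> N input = concat (map (written \<A> N input) [0..<rounds \<A>])"

text \<open>
  In every round each machine sends at most \<open>s\<close> words, receives at most \<open>s\<close> words and
  keeps at most \<open>s\<close> words; the output machine writes at most \<open>s\<close> words.
\<close>

definition within_space :: "nat \<Rightarrow> nat \<Rightarrow> mpc_algorithm \<Rightarrow> (nat \<Rightarrow> nat list) \<Rightarrow> bool" where
  "within_space N s \<A> input \<longleftrightarrow>
     (\<forall>t < rounds \<A>. \<forall>k < N.
        (\<Sum>l<N. length (sent \<A> N input t k l)) \<le> s \<and>
        (\<Sum>l<N. length (sent \<A> N input t l k)) \<le> s \<and>
        length (memory \<A> N input (Suc t) k) \<le> s \<and>
        (\<forall>l < N. set (sent \<A> N input t k l) \<subseteq> {..<N}) \<and>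
        set (memory \<A> N input (Suc t) k) \<subseteq> {..<N}) \<and>
     (\<forall>t < rounds \<A>. length (written \<A> N input t) \<le> s \<and>
        set (written \<A> N input t) \<subseteq> {..<N})"

text \<open>
  An edge \<open>{u, v}\<close> with \<open>u < v < n\<close> is the single word \<open>u * n + v < n\<^sup>2\<close>. Every edge lies on
  exactly one machine, in no particular order.
\<close>

definition edge_distribution ::
  "nat \<Rightarrow> nat set set \<Rightarrow> nat \<Rightarrow> nat \<Rightarrow> (nat \<Rightarrow> nat list) \<Rightarrow> bool" where
  "edge_distribution n E N s input \<longleftrightarrow>
     (\<forall>k < N. distinct (input k) \<and> length (input k) \<le> s) \<and>
     (\<forall>k < N. \<forall>l < N. k \<noteq> l \<longrightarrow> set (input k) \<inter> set (input l) = {}) \<and>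
     (\<Union>k<N. set (input k)) = {u * n + v | u v. u < v \<and> v < n \<and> {u, v} \<in> E}"

definition mpc_computes ::
  "nat \<Rightarrow> nat \<Rightarrow> mpc_algorithm \<Rightarrow> (nat \<Rightarrow> nat list) \<Rightarrow> real \<Rightarrow> bool" where
  "mpc_computes N s \<A> input x \<longleftrightarrow>
     within_space N s \<A> input \<and> decode \<A> (mpc_output \<A> N input) = x"

text \<open>
  Numbers that can be given in a bounded number of \<open>O(log n)\<close>-bit words: fractions whose
  denominator is at most \<open>n ^ \<kappa>\<close>.
\<close>

definition word_fraction :: "nat \<Rightarrow> nat \<Rightarrow> real \<Rightarrow> bool" where
  "word_fraction \<kappa> n q \<longleftrightarrow> (\<exists>a b :: nat. 0 < b \<and> b \<le> n ^ \<kappa> \<and> q = real a / real b)"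

end

theory Submission
  imports Defs "HOL-Computational_Algebra.Polynomial" "HOL-Real_Asymp.Real_Asymp"
begin

text \<open>
  Since \<open>B\<close> is symmetric, the square of the norm is \<open>x\<^sup>T B\<^bsup>2r\<^esup> x\<close> for \<open>x = e\<^sub>i - e\<^sub>j\<close>: it takes
  \<open>2 r\<close> matrix-vector products and no product of long numbers.

  Summing \<open>s\<close> numbers at a time in memory \<open>s\<close> requires numbers of a single word. For \<open>q = a / b\<close> the iteration
  \<open>x \<leftarrow> (b A - a J) x\<close> is therefore carried out modulo each of \<open>R\<close> consecutive numbers
  \<open>m, \<dots>, m + R - 1\<close> in parallel, where \<open>m\<close> is a power of \<open>n\<close>. Their least common multiple is a
  multiple of \<open>m * ((m + R - 1) choose (R - 1))\<close>, so \<open>R = O(log n)\<close> residues determine the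
  result, and the constant is as small as we like if words are long enough.

  For any other \<open>q\<close> the result is a polynomial in \<open>q\<close> with integer coefficients, which is
  determined by its value at one sufficiently large integer. That value takes \<open>O(r log n)\<close>
  residues, which are written in \<open>r\<close> portions of \<open>s\<close> words.

  Every product sums and broadcasts along trees of degree \<open>f \<le> s\<close> and depth \<open>\<lceil>log\<^sub>s n\<rceil>\<close>.
\<close>

section \<open>Iterating a shifted adjacency matrix\<close>

text \<open>The iteration by b A - a J started at e_i - e_j. It is generic in the ring because it is
  used over the integers (in the circuit), the reals (for the norm) and polynomials in the
  indeterminate \<open>[:0, 1:]\<close> (for arbitrary q).\<close>

primrec shift_iter :: "nat \<Rightarrow> nat set set \<Rightarrow> 'a \<Rightarrow> 'a \<Rightarrow> nat \<Rightarrow> nat \<Rightarrow> nat \<Rightarrow> nat \<Rightarrow> 'a::comm_ring_1" where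
  "shift_iter n E a b i j 0 = (\<lambda>v. of_bool (v = i) - of_bool (v = j))"
| "shift_iter n E a b i j (Suc t) =
     (\<lambda>v. \<Sum>u<n. (b * of_bool ({v, u} \<in> E) - a) * shift_iter n E a b i j t u)"

text \<open>The quadratic form x^T M^t x with x = e_i - e_j and M = b A - a J.\<close>

definition shift_form :: "nat \<Rightarrow> nat set set \<Rightarrow> 'a \<Rightarrow> 'a \<Rightarrow> nat \<Rightarrow> nat \<Rightarrow> nat \<Rightarrow> 'a::comm_ring_1" where
  "shift_form n E a b i j t = shift_iter n E a b i j t i - shift_iter n E a b i j t j"

section \<open>Change of ring, scaling and size of the iterates\<close>

lemma of_int_shift_iter:
  "of_int (shift_iter n E a b i j t v) = shift_iter n E (of_int a) (of_int b) i j t v"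
  by (induction t arbitrary: v) (auto intro!: sum.cong)

text \<open>Every step pulls one factor \<open>b\<close> out of b A - b x J = b (A - x J).\<close>

lemma shift_iter_scale:
  fixes x :: "'a::comm_ring_1"
  shows "shift_iter n E (b * x) b i j t v = b ^ t * shift_iter n E x 1 i j t v"
  by (induction t arbitrary: v) (auto simp: sum_distrib_left algebra_simps intro!: sum.cong)

lemma poly_shift_iter:
  fixes x :: "'a::comm_ring_1"
  shows "poly (shift_iter n E [:0, 1:] 1 i j t v) x = shift_iter n E x 1 i j t v"
  by (induction t arbitrary: v) (auto simp: poly_sum of_bool_def intro!: sum.cong)

text \<open>Multiplication by the indeterminate shifts coefficients, so these satisfy a recursion of
  their own; both their integrality and their size are read off from it.\<close>

lemma coeff_shift_iter_Suc:
  "coeff (shift_iter n E [:0, 1:] 1 i j (Suc t) v :: 'a::comm_ring_1 poly) k =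
   (\<Sum>u<n. of_bool ({v, u} \<in> E) * coeff (shift_iter n E [:0, 1:] 1 i j t u) k
     - (case k of 0 \<Rightarrow> 0 | Suc k' \<Rightarrow> coeff (shift_iter n E [:0, 1:] 1 i j t u) k'))"
  by (auto simp: coeff_sum left_diff_distrib coeff_pCons intro!: sum.cong split: nat.split)

lemma of_int_coeff_shift_iter:
  "of_int (coeff (shift_iter n E [:0, 1:] 1 i j t v) k) =
   coeff (shift_iter n E [:0, 1:] 1 i j t v :: 'a::comm_ring_1 poly) k"
proof (induction t arbitrary: v k)
  case 0
  then show ?case by (cases k) auto
next
  case (Suc t)
  show ?case unfolding coeff_shift_iter_Suc
    by (auto simp: Suc intro!: sum.cong split: nat.split)
qed

lemma abs_shift_iter_le:
  fixes a b :: int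
  assumes "0 \<le> a" and "0 \<le> b"
  shows "\<bar>shift_iter n E a b i j t v\<bar> \<le> (int n * (a + b)) ^ t"
proof (induction t arbitrary: v)
  case (Suc t)
  have "\<bar>shift_iter n E a b i j (Suc t) v\<bar> \<le>
    (\<Sum>u<n. \<bar>b * of_bool ({v, u} \<in> E) - a\<bar> * \<bar>shift_iter n E a b i j t u\<bar>)"
    by (simp add: abs_mult[symmetric])
  also have "\<dots> \<le> (\<Sum>u<n. (a + b) * (int n * (a + b)) ^ t)"
    using assms Suc by (intro sum_mono mult_mono) (auto simp: of_bool_def)
  finally show ?case by (simp add: mult.assoc)
qed auto

text \<open>Each of the n summands combines at most two earlier coefficients, hence a factor 2 n per
  step.\<close>

lemma abs_coeff_shift_iter_le:
  "\<bar>coeff (shift_iter n E [:0, 1:] 1 i j t v :: int poly) k\<bar> \<le> (2 * int n) ^ t"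
proof (induction t arbitrary: v k)
  case 0
  then show ?case by (cases k) auto
next
  case (Suc t)
  let ?c = "\<lambda>u. coeff (shift_iter n E [:0, 1:] 1 i j t u :: int poly)"
  have le: "\<bar>of_bool ({v, u} \<in> E) * ?c u k - (case k of 0 \<Rightarrow> 0 | Suc k' \<Rightarrow> ?c u k')\<bar>
      \<le> 2 * (2 * int n) ^ t" for u
  proof -
    have "\<bar>of_bool ({v, u} \<in> E) * ?c u k\<bar> \<le> (2 * int n) ^ t"
      using Suc[of u k] by auto
    moreover have "\<bar>case k of 0 \<Rightarrow> 0 | Suc k' \<Rightarrow> ?c u k'\<bar> \<le> (2 * int n) ^ t"
      using Suc[of u] by (auto split: nat.split)
    ultimately show ?thesis by linarith
  qed
  have "\<bar>coeff (shift_iter n E [:0, 1:] 1 i j (Suc t) v :: int poly) k\<bar> \<le>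
    (\<Sum>u<n. \<bar>of_bool ({v, u} \<in> E) * ?c u k - (case k of 0 \<Rightarrow> 0 | Suc k' \<Rightarrow> ?c u k')\<bar>)"
    unfolding coeff_shift_iter_Suc by (rule sum_abs)
  also have "\<dots> \<le> (\<Sum>u<n. 2 * (2 * int n) ^ t)"
    by (intro sum_mono le)
  finally show ?case by (simp add: mult.assoc mult.left_commute)
qed

text \<open>Modulo \<open>X\<close> only the constant coefficient survives; being a multiple of
  \<open>X\<close> smaller than \<open>X\<close>, it is zero. Then the indeterminate is divided
  out.\<close>

lemma poly_eq_0_small_coeffs:
  fixes p :: "int poly"
  assumes "\<And>k. \<bar>coeff p k\<bar> < X" and "poly p X = 0"
  shows "p = 0"
  using assms
proof (induction p)
  case (pCons c p)
  have "X dvd c" using pCons.prems(2) by (simp add: eq_neg_iff_add_eq_0[symmetric])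
  moreover have "\<bar>c\<bar> < X" using pCons.prems(1)[of 0] by simp
  ultimately have "c = 0" using zdvd_not_zless[of "\<bar>c\<bar>" X] by (cases "c = 0") auto
  moreover have "poly p X = 0" using pCons.prems \<open>c = 0\<close> \<open>\<bar>c\<bar> < X\<close> by simp
  moreover have "\<bar>coeff p k\<bar> < X" for k using pCons.prems(1)[of "Suc k"] by simp
  ultimately show ?case using pCons.IH by auto
qed simp

text \<open>The integer polynomials of the two graphs agree at \<open>X\<close>. Their difference
  has coefficients of size at most \<open>4 * (2 * int n) ^ t\<close>, so it is zero, and the forms
  then agree at every point of every commutative ring.\<close>

lemma shift_form_determined:
  fixes X :: int and x :: "'a::comm_ring_1"
  assumes X: "4 * (2 * int n) ^ t < X"
    and eq: "shift_form n E X 1 i j t = shift_form n E' X 1 i j t"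
  shows "shift_form n E x 1 i j t = shift_form n E' x 1 i j t"
proof -
  define p :: "nat set set \<Rightarrow> int poly" where
    "p = (\<lambda>E. shift_iter n E [:0, 1:] 1 i j t i - shift_iter n E [:0, 1:] 1 i j t j)"
  define p' :: "nat set set \<Rightarrow> 'a poly" where
    "p' = (\<lambda>E. shift_iter n E [:0, 1:] 1 i j t i - shift_iter n E [:0, 1:] 1 i j t j)"
  have "\<bar>coeff (p E - p E') k\<bar> < X" for k
    using X abs_coeff_shift_iter_le[of n E i j t i k] abs_coeff_shift_iter_le[of n E i j t j k]
      abs_coeff_shift_iter_le[of n E' i j t i k] abs_coeff_shift_iter_le[of n E' i j t j k]
    unfolding p_def by simp
  moreover have "poly (p E - p E') X = 0"
    using eq by (simp add: p_def poly_shift_iter shift_form_def)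
  ultimately have "p E = p E'"
    using poly_eq_0_small_coeffs[of "p E - p E'" X] by simp
  moreover have "coeff (p' E) k = of_int (coeff (p E) k)" for E k
    by (simp add: p_def p'_def of_int_coeff_shift_iter)
  ultimately have "p' E = p' E'"
    by (simp add: poly_eq_iff)
  moreover have "shift_form n E x 1 i j t = poly (p' E) x" for E
    by (simp add: p'_def shift_form_def poly_shift_iter)
  ultimately show ?thesis by simp
qed

section \<open>The norm as a quadratic form\<close>

lemma sum_shift_matrix_symmetric:
  fixes y z :: "nat \<Rightarrow> 'a::comm_ring_1"
  shows "(\<Sum>v<n. (\<Sum>u<n. (b * of_bool ({v, u} \<in> E) - a) * y u) * z v) =
    (\<Sum>v<n. y v * (\<Sum>u<n. (b * of_bool ({v, u} \<in> E) - a) * z u))"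
  unfolding sum_distrib_left sum_distrib_right
  by (subst sum.swap) (auto simp: insert_commute algebra_simps intro!: sum.cong)

text \<open>Symmetry of the matrix moves the steps of the second factor to the first, one at a
  time.\<close>

lemma sum_shift_iter_mult:
  fixes a b :: "'a::comm_ring_1"
  shows "(\<Sum>v<n. shift_iter n E a b i j t v * shift_iter n E a b i j t' v) =
    (\<Sum>v<n. shift_iter n E a b i j (t + t') v * shift_iter n E a b i j 0 v)"
proof (induction t' arbitrary: t)
  case (Suc t')
  show ?case
    using Suc[of "Suc t"] sum_shift_matrix_symmetric
      [where n = n and E = E and a = a and b = b and y = "shift_iter n E a b i j t"
        and z = "shift_iter n E a b i j t'"]
    by simp
qed simp

lemma norm_row_diff:
  fixes q :: real
  assumes "i < n" and "j < n"
  shows "euclidean_norm (row (shifted_adjacency n E q ^\<^sub>m r) i - row (shifted_adjacency n E q ^\<^sub>m r) j) =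
    sqrt (shift_form n E q 1 i j (2 * r))"
proof -
  let ?B = "shifted_adjacency n E q"
  have B: "?B \<in> carrier_mat n n"
    by (auto simp: shifted_adjacency_def adjacency_def all_ones_def)
  \<comment> \<open>By symmetry the column \<open>v\<close> of B is written as a row, so that
    multiplying by B from the right matches the recursion of \<open>shift_iter\<close>.\<close>
  have Bnth: "?B $$ (u, v) = of_bool ({v, u} \<in> E) - q" if "u < n" "v < n" for u v
    using that by (simp add: shifted_adjacency_def adjacency_def all_ones_def insert_commute)
  have pow: "?B ^\<^sub>m t \<in> carrier_mat n n" for t
    using B by simp
  have entry: "(?B ^\<^sub>m t) $$ (i, v) - (?B ^\<^sub>m t) $$ (j, v) = shift_iter n E q 1 i j t v" if "v < n" for t v
    using that
  proof (induction t arbitrary: v)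
    case 0
    then show ?case using assms B by auto
  next
    case (Suc t)
    have *: "(?B ^\<^sub>m Suc t) $$ (k, v) = (\<Sum>u<n. (?B ^\<^sub>m t) $$ (k, u) * ?B $$ (u, v))" if "k < n" for k
      using that Suc.prems pow[of t] B by (auto simp: scalar_prod_def lessThan_atLeast0 intro!: sum.cong)
    have "(?B ^\<^sub>m Suc t) $$ (i, v) - (?B ^\<^sub>m Suc t) $$ (j, v) =
      (\<Sum>u<n. ?B $$ (u, v) * ((?B ^\<^sub>m t) $$ (i, u) - (?B ^\<^sub>m t) $$ (j, u)))"
      unfolding *[OF assms(1)] *[OF assms(2)] sum_subtractf[symmetric]
      by (intro sum.cong) (auto simp: algebra_simps)
    also have "\<dots> = (\<Sum>u<n. (of_bool ({v, u} \<in> E) - q) * shift_iter n E q 1 i j t u)"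
      using Suc by (intro sum.cong) (auto simp: Bnth)
    finally show ?case by simp
  qed
  let ?d = "row (?B ^\<^sub>m r) i - row (?B ^\<^sub>m r) j"
  have "?d \<bullet> ?d = (\<Sum>v<n. shift_iter n E q 1 i j r v * shift_iter n E q 1 i j r v)"
    using carrier_matD[OF B] assms entry[of _ r]
    by (auto simp: scalar_prod_def lessThan_atLeast0 intro!: sum.cong)
  also have "\<dots> = (\<Sum>v<n. shift_iter n E q 1 i j (2 * r) v * (of_bool (v = i) - of_bool (v = j)))"
    by (simp add: sum_shift_iter_mult mult_2)
  also have "\<dots> = shift_form n E q 1 i j (2 * r)"
    using assms by (simp add: right_diff_distrib sum_subtractf shift_form_def)
  finally show ?thesis by (simp add: euclidean_norm_def)
qed

text \<open>With \<open>\<beta>(a, m) = 1 / (a * ((a + m) choose m))\<close> the induction step is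
  \<open>\<beta>(a, m + 1) = \<beta>(a, m) - \<beta>(a + 1, m)\<close>.\<close>

lemma dvd_consecutive:
  fixes z :: int
  assumes "0 < a" and "\<And>h. h \<le> m \<Longrightarrow> int (a + h) dvd z"
  shows "int (a * ((a + m) choose m)) dvd z"
  using assms
proof (induction m arbitrary: a)
  case (Suc m)
  have "int (a * ((a + m) choose m)) dvd z" using Suc.prems by (intro Suc.IH) auto
  then obtain x where x: "z = int (a * ((a + m) choose m)) * x" by blast
  have "int (Suc a * ((Suc a + m) choose m)) dvd z" 
  proof (intro Suc.IH)
    fix h assume "h \<le> m"
    then show "int (Suc a + h) dvd z" using Suc.prems(2)[of "Suc h"] by simp
  qed simp
  then obtain y where y: "z = int (Suc a * ((Suc a + m) choose m)) * y" by blast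
  have 1: "Suc m * ((a + Suc m) choose Suc m) = (a + Suc m) * ((a + m) choose m)"
    using Suc_times_binomial_eq[of "a + m" m] by (simp add: mult.commute)
  have 2: "Suc a * ((Suc a + m) choose m) = (a + Suc m) * ((a + m) choose m)"
    using binomial_absorb_comp[of "Suc a + m" m] by simp
  \<comment> \<open>In the notation above, \<open>x\<close> and \<open>y\<close> are z times
    \<beta>(a, m) and \<beta>(a + 1, m), so the new quotient is \<open>x - y\<close>. The factor
    \<open>Suc m\<close> avoids fractions.\<close>
  have "int (Suc m) * z = int (Suc m) * (int (a * ((a + Suc m) choose Suc m)) * (x - y))"
  proof -
    have "int (Suc m) * (int (a * ((a + Suc m) choose Suc m)) * (x - y)) =
      int a * int (Suc m * ((a + Suc m) choose Suc m)) * (x - y)" by (simp only: of_nat_mult mult_ac)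
    also have "\<dots> = (int a + int (Suc m)) * (int (a * ((a + m) choose m)) * x)
       - int a * (int ((a + Suc m) * ((a + m) choose m)) * y)"
      unfolding 1 by (simp add: algebra_simps)
    also have "\<dots> = (int a + int (Suc m)) * z - int a * z"
      unfolding 2[symmetric] x[symmetric] y[symmetric] by (rule refl)
    finally show ?thesis by (simp add: algebra_simps)
  qed
  then have "z = int (a * ((a + Suc m) choose Suc m)) * (x - y)" by simp
  then show ?case by (metis dvd_triv_left)
qed simp

text \<open>The difference is divisible by R consecutive numbers from \<open>n ^ Suc e\<close> on,
  hence by a product with a binomial coefficient that is at least \<open>n ^ (e * R)\<close>. It is
  smaller than that, so it vanishes.\<close>

lemma residues_determine:
  fixes y z :: int and n e R :: nat
  assumes "1 \<le> n" and "1 \<le> R" and "R \<le> n"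
    and cong: "\<And>h. h < R \<Longrightarrow> y mod int (n ^ Suc e + h) = z mod int (n ^ Suc e + h)"
    and "\<bar>y\<bar> + \<bar>z\<bar> < int n ^ (e * R)"
  shows "y = z"
proof (rule ccontr)
  assume "y \<noteq> z"
  define m where "m = R - 1"
  define a where "a = n ^ Suc e"
  have a: "0 < a" using assms by (simp add: a_def)
  have "int (a * ((a + m) choose m)) dvd y - z"
    using cong assms(2) a
    by (intro dvd_consecutive) (auto simp: m_def a_def mod_eq_dvd_iff)
  then have "int (a * ((a + m) choose m)) \<le> \<bar>y - z\<bar>"
    using \<open>y \<noteq> z\<close> dvd_imp_le_int[of "y - z"] by force
  also have "\<dots> < int n ^ (e * R)" using assms(5) by linarith
  finally have lt: "a * ((a + m) choose m) < n ^ (e * R)" 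
    by (metis of_nat_less_iff of_nat_power)
  \<comment> \<open>Since \<open>m < R \<le> n\<close>, the extra factor n in
    \<open>a = n ^ Suc e\<close> pays for the division by \<open>m\<close>.\<close>
  have "real n ^ e \<le> real (a + m) / real m" if "m \<noteq> 0"
  proof -
    have "real n ^ e * real m \<le> real n ^ e * real n" using assms m_def by (intro mult_left_mono) auto
    also have "\<dots> \<le> real (a + m)" by (simp add: a_def)
    finally show ?thesis using that by (simp add: field_simps)
  qed
  then have "(real n ^ e) ^ m \<le> (real (a + m) / real m) ^ m"
    by (cases "m = 0") (auto intro!: power_mono)
  also have "\<dots> \<le> real ((a + m) choose m)" by (rule binomial_ge_n_over_k_pow_k) simp
  finally have "n ^ (e * m) \<le> (a + m) choose m"
    by (metis of_nat_le_iff of_nat_power power_mult)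
  then have "n ^ e * n ^ (e * m) \<le> a * ((a + m) choose m)"
    using assms(1) by (intro mult_mono) (auto simp: a_def)
  also have "n ^ e * n ^ (e * m) = n ^ (e * R)"
    using assms(2) by (simp add: m_def power_add[symmetric] flip: mult_Suc_right)
  finally show False using lt by simp
qed

section \<open>Layered circuits as MPC algorithms\<close>

type_synonym layer = "(nat \<Rightarrow> nat list) \<times> (nat \<Rightarrow> nat list \<Rightarrow> nat)"

text \<open>A layer gives for every node its predecessors in the previous layer and its operation.
  Values are reduced modulo \<open>N\<close> so that each of them is a word.\<close>

definition layer_apply :: "nat \<Rightarrow> layer \<Rightarrow> (nat \<Rightarrow> nat) \<Rightarrow> nat \<Rightarrow> nat" where
  "layer_apply N L V = (\<lambda>k. snd L k (map V (fst L k)) mod N)"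

definition run :: "nat \<Rightarrow> layer list \<Rightarrow> (nat \<Rightarrow> nat) \<Rightarrow> nat \<Rightarrow> nat" where
  "run N P = fold (layer_apply N) P"

text \<open>Fan-in bounds what a machine receives and keeps, fan-out what it sends.\<close>

definition valid_layer :: "nat \<Rightarrow> nat \<Rightarrow> layer \<Rightarrow> bool" where
  "valid_layer N s L \<longleftrightarrow>
     (\<forall>k<N. distinct (fst L k) \<and> length (fst L k) \<le> s \<and> set (fst L k) \<subseteq> {..<N}) \<and>
     (\<forall>l<N. card {k. k < N \<and> l \<in> set (fst L k)} \<le> s)"

lemma run_Nil [simp]: "run N [] V = V"
  by (simp add: run_def)

lemma run_Cons [simp]: "run N (L # P) V = run N P (layer_apply N L V)"
  by (simp add: run_def)

lemma run_append [simp]: "run N (P @ Q) V = run N Q (run N P V)"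
  by (simp add: run_def)

definition edge_words :: "nat \<Rightarrow> nat set set \<Rightarrow> nat set" where
  "edge_words n E = {u * n + v | u v. u < v \<and> v < n \<and> {u, v} \<in> E}"

definition edge_bit :: "nat \<Rightarrow> nat set set \<Rightarrow> nat \<Rightarrow> nat" where
  "edge_bit n E k = of_bool (k \<in> edge_words n E)"

text \<open>Evaluation is postponed until a value is sent: from the memory after round
  \<open>t\<close>, counting from 0, this gives the value of the node after the first
  \<open>t\<close> layers.\<close>

definition node_value :: "nat \<Rightarrow> layer list \<Rightarrow> nat \<Rightarrow> nat \<Rightarrow> nat list \<Rightarrow> nat" where
  "node_value N P t k m = (case t of 0 \<Rightarrow> of_bool (m \<noteq> []) | Suc t' \<Rightarrow> snd (P ! t') k m mod N)"

text \<open>Round 0 sends every edge word to the machine of that name. In each later round a machine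
  stores the values of the predecessors of its node in the current layer, unevaluated.\<close>

definition layered_algorithm ::
  "nat \<Rightarrow> layer list \<Rightarrow> nat \<Rightarrow> (nat list \<Rightarrow> real) \<Rightarrow> mpc_algorithm" where
  "layered_algorithm N P T dec =
     \<lparr>rounds = Suc (length P),
      message = (\<lambda>t k m l. case t of 0 \<Rightarrow> if l \<in> set m then [l] else []
        | Suc t' \<Rightarrow> if k \<in> set (fst (P ! t') l) then [node_value N P t' k m] else []),
      update = (\<lambda>t k m inbox. case t of 0 \<Rightarrow> concat (map inbox [0..<N])
        | Suc t' \<Rightarrow> concat (map inbox (fst (P ! t') k))),
      emit = (\<lambda>t m. if t \<le> T then [] else m),
      decode = dec\<rparr>"

lemma message_layered_Suc:
  "message (layered_algorithm N P T dec) (Suc t) k m l =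
     (if k \<in> set (fst (P ! t) l) then [node_value N P t k m] else [])"
  by (simp add: layered_algorithm_def)

lemma update_layered_Suc:
  "update (layered_algorithm N P T dec) (Suc t) k m inbox = concat (map inbox (fst (P ! t) k))"
  by (simp add: layered_algorithm_def)

lemma concat_map_singleton_at:
  assumes "distinct xs" and "a \<in> set xs" and "\<And>x. x \<in> set xs \<Longrightarrow> x \<noteq> a \<Longrightarrow> g x = []"
  shows "concat (map g xs) = g a"
  using assms
proof (induction xs)
  case (Cons x xs)
  show ?case
  proof (cases "x = a")
    case True
    then have "concat (map g xs) = []" using Cons.prems by auto
    then show ?thesis using True by simp
  next
    case False
    then show ?thesis using Cons by auto
  qed
qed simp

text \<open>Each edge lies on exactly one machine, so a machine named by an edge word has one sender
  and any other machine has none.\<close>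

lemma memory_layered_Suc_0:
  assumes "edge_distribution n E N s input" and "k < N"
  shows "memory (layered_algorithm N P T dec) N input (Suc 0) k =
    (if k \<in> edge_words n E then [k] else [])"
proof -
  define g where "g = (\<lambda>l. if k \<in> set (input l) then [k] else [])"
  have un: "(\<Union>k<N. set (input k)) = edge_words n E"
    and disj: "\<And>k l. k < N \<Longrightarrow> l < N \<Longrightarrow> k \<noteq> l \<Longrightarrow> set (input k) \<inter> set (input l) = {}"
    using assms(1) by (auto simp: edge_distribution_def edge_words_def)
  have *: "memory (layered_algorithm N P T dec) N input (Suc 0) k = concat (map g [0..<N])"
    by (auto simp: layered_algorithm_def g_def intro!: arg_cong[where f = concat])
  show ?thesis
  proof (cases "k \<in> edge_words n E")
    case True
    then obtain l where l: "l < N" "k \<in> set (input l)" using un by auto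
    have "concat (map g [0..<N]) = g l"
      using l disj by (intro concat_map_singleton_at) (auto simp: g_def)
    then show ?thesis using * True l by (simp add: g_def)
  next
    case False
    then show ?thesis using * un by (auto simp: g_def)
  qed
qed

text \<open>The senders hold the arguments of the layer before, by induction, and evaluate them on
  sending; for the first layer they send edge bits.\<close>

lemma memory_layered_Suc_Suc:
  assumes "edge_distribution n E N s input" and "\<forall>L \<in> set P. valid_layer N s L"
    and "k < N" and "t < length P"
  shows "memory (layered_algorithm N P T dec) N input (Suc (Suc t)) k =
    map (run N (take t P) (edge_bit n E)) (fst (P ! t) k)"
  using assms(3,4)
proof (induction t arbitrary: k rule: less_induct)
  case (less t)
  let ?A = "layered_algorithm N P T dec"
  have valid: "valid_layer N s (P ! t)" using assms(2) less.prems by simp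
  have val: "node_value N P t l (memory ?A N input (Suc t) l) = run N (take t P) (edge_bit n E) l"
    if "l < N" for l
  proof (cases t)
    case 0
    then show ?thesis
      using memory_layered_Suc_0[OF assms(1) that] by (simp add: node_value_def edge_bit_def)
  next
    case (Suc t')
    have "memory ?A N input (Suc t) l = map (run N (take t' P) (edge_bit n E)) (fst (P ! t') l)"
      using less.IH[of t' l] less.prems Suc that by simp
    moreover have "take t P = take t' P @ [P ! t']"
      using Suc less.prems by (simp add: take_Suc_conv_app_nth)
    ultimately show ?thesis using Suc by (simp add: node_value_def layer_apply_def)
  qed
  have "memory ?A N input (Suc (Suc t)) k =
    concat (map (\<lambda>l. if l < N then if l \<in> set (fst (P ! t) k)
      then [node_value N P t l (memory ?A N input (Suc t) l)] else [] else []) (fst (P ! t) k))"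
    unfolding memory.simps(2)[of _ _ _ "Suc t"]
    by (simp only: update_layered_Suc message_layered_Suc)
  also have "\<dots> = concat (map (\<lambda>l. [run N (take t P) (edge_bit n E) l]) (fst (P ! t) k))"
    using valid less.prems val
    by (intro arg_cong[where f = concat] map_cong refl) (auto simp: valid_layer_def)
  finally show ?case by simp
qed

lemma sum_length_if_singleton:
  fixes N :: nat
  shows
  "(\<Sum>l<N. length (if Q l then [x l] else [])) = card {l. l < N \<and> Q l}"
proof -
  have "(\<Sum>l<N. length (if Q l then [x l] else [])) = (\<Sum>l<N. if Q l then 1 else 0)"
    by (intro sum.cong) auto
  also have "\<dots> = card {l \<in> {..<N}. Q l}"
    by (subst sum.inter_filter[symmetric]) auto
  finally show ?thesis by simp
qed

text \<open>Layer \<open>t\<close> is executed in round \<open>Suc t\<close>, after the delivery of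
  the edges. Machine 0 is silent for the first \<open>T\<close> layers and then writes the
  unevaluated arguments of node 0 in every further layer.\<close>

lemma layered_algorithm_correct:
  fixes dec :: "nat list \<Rightarrow> real"
  assumes dist: "edge_distribution n E N s input" and val: "\<forall>L \<in> set P. valid_layer N s L"
    and N: "2 \<le> N" and s: "1 \<le> s" and T: "T \<le> length P"
  defines "\<A> \<equiv> layered_algorithm N P T dec"
  shows "within_space N s \<A> input"
    and "mpc_output \<A> N input = concat (map (\<lambda>t.
      map (run N (take t P) (edge_bit n E)) (fst (P ! t) 0)) [T..<length P])"
proof -
  let ?V = "\<lambda>t. run N (take t P) (edge_bit n E)"
  have mem0: "memory \<A> N input (Suc 0) k = (if k \<in> edge_words n E then [k] else [])" if "k < N" for k
    using memory_layered_Suc_0[OF dist that] by (simp add: \<A>_def)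
  have mem: "memory \<A> N input (Suc (Suc t)) k = map (?V t) (fst (P ! t) k)"
    if "k < N" "t < length P" for t k
    using memory_layered_Suc_Suc[OF dist val that] by (simp add: \<A>_def)
  have rounds: "rounds \<A> = Suc (length P)"
    by (simp add: \<A>_def layered_algorithm_def)
  have sent0: "sent \<A> N input 0 k l = (if l \<in> set (input k) then [l] else [])" for k l
    by (simp add: sent_def \<A>_def layered_algorithm_def)
  have sent: "sent \<A> N input (Suc t) k l = (if k \<in> set (fst (P ! t) l)
      then [node_value N P t k (memory \<A> N input (Suc t) k)] else [])" for t k l
    by (simp only: sent_def \<A>_def message_layered_Suc)
  have node: "node_value N P t k (memory \<A> N input (Suc t) k) < N" for t k
    using N by (cases t) (auto simp: node_value_def)
  have V: "?V t k < N" if "t \<le> length P" for t k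
    using that N by (cases t) (auto simp: edge_bit_def take_Suc_conv_app_nth layer_apply_def)
  have layer: "valid_layer N s (P ! t)" if "t < length P" for t
    using val that by simp
  have mem_len: "length (memory \<A> N input (Suc t) k) \<le> s"
    and mem_set: "set (memory \<A> N input (Suc t) k) \<subseteq> {..<N}" if "t \<le> length P" "k < N" for t k
  proof -
    have "length (memory \<A> N input (Suc t) k) \<le> s \<and> set (memory \<A> N input (Suc t) k) \<subseteq> {..<N}"
    proof (cases t)
      case 0
      then show ?thesis using mem0[OF that(2)] that(2) s by (simp del: memory.simps)
    next
      case (Suc t')
      then show ?thesis
        using mem[OF that(2), of t'] layer[of t'] that V[of t']
        by (auto simp: valid_layer_def simp del: memory.simps)
    qed
    then show "length (memory \<A> N input (Suc t) k) \<le> s" "set (memory \<A> N input (Suc t) k) \<subseteq> {..<N}"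
      by auto
  qed
  have traffic: "(\<Sum>l<N. length (sent \<A> N input t k l)) \<le> s \<and>
      (\<Sum>l<N. length (sent \<A> N input t l k)) \<le> s" if "t \<le> length P" "k < N" for t k
  proof (cases t)
    case 0
    have "card {l. l < N \<and> l \<in> set (input k)} \<le> card (set (input k))"
      by (intro card_mono) auto
    also have "\<dots> \<le> s"
      using dist that(2) card_length[of "input k"] by (force simp: edge_distribution_def)
    finally have 1: "card {l. l < N \<and> l \<in> set (input k)} \<le> s" .
    \<comment> \<open>The inputs are disjoint, so the word \<open>k\<close> has at most one
      sender.\<close>
    have "card {l. l < N \<and> k \<in> set (input l)} \<le> 1"
      using dist by (auto simp: card_le_Suc0_iff_eq edge_distribution_def)
    then show ?thesis
      using 0 1 s by (simp only: sent0 sum_length_if_singleton) simp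
  next
    case (Suc t')
    then have v: "valid_layer N s (P ! t')" using layer that by simp
    have "{l. l < N \<and> l \<in> set (fst (P ! t') k)} = set (fst (P ! t') k)"
      using v that(2) by (auto simp: valid_layer_def)
    then have "card {l. l < N \<and> l \<in> set (fst (P ! t') k)} \<le> s"
      using v that(2) card_length[of "fst (P ! t') k"] by (force simp: valid_layer_def)
    then show ?thesis
      using v that(2) Suc by (simp only: sent sum_length_if_singleton) (simp add: valid_layer_def)
  qed
  have sent_set: "set (sent \<A> N input t k l) \<subseteq> {..<N}" if "l < N" for t k l
    using that node by (cases t) (auto simp: sent0 sent simp del: memory.simps)
  have wr: "written \<A> N input t = (if t \<le> T then [] else memory \<A> N input (Suc t) 0)" for t
    by (simp add: written_def \<A>_def layered_algorithm_def)
  show "within_space N s \<A> input"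
    using mem_len mem_set traffic sent_set N s
    by (auto simp: within_space_def rounds wr less_Suc_eq_le simp del: memory.simps)
  have "mpc_output \<A> N input = concat (map (written \<A> N input) ([0..<Suc T] @ [Suc T..<Suc (length P)]))"
    using T upt_add_eq_append[of 0 "Suc T" "length P - T"]
    by (simp add: mpc_output_def rounds del: upt_Suc)
  also have "\<dots> = concat (map (written \<A> N input) [Suc T..<Suc (length P)])"
    by (auto simp: wr simp del: upt_Suc)
  also have "\<dots> = concat (map (\<lambda>t. written \<A> N input (Suc t)) [T..<length P])"
    by (simp only: map_Suc_upt[symmetric] map_map o_def)
  also have "\<dots> = concat (map (\<lambda>t. map (?V t) (fst (P ! t) 0)) [T..<length P])"
    using mem N by (intro arg_cong[where f = concat] map_cong refl) (auto simp: wr simp del: memory.simps)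
  finally show "mpc_output \<A> N input = concat (map (\<lambda>t. map (?V t) (fst (P ! t) 0)) [T..<length P])" .
qed

section \<open>A circuit for the iteration\<close>

lemma mixed_radix_less:
  fixes h :: nat
  assumes "h < A" and "v < B"
  shows "h * B + v < A * B"
proof -
  have "h * B + v < Suc h * B" using assms by simp
  also have "\<dots> \<le> A * B" using assms by (intro mult_right_mono) auto
  finally show ?thesis .
qed

lemma card_le_if_subset_pair:
  assumes "S \<subseteq> {x, y}"
  shows "card S \<le> 2"
  using card_mono[OF _ assms] card_insert_le_m1[of 2 "{y}" x] by (simp add: card_insert_if split: if_splits)

text \<open>The outer \<open>min\<close> cuts off the last portion; portions that would start beyond
  \<open>R\<close> are empty.\<close>

lemma concat_chunks:
  "concat (map (\<lambda>c. [A + c * s..<A + min (Suc c * s) R]) [0..<T]) = [A..<A + min (T * s) R]"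
proof (induction T)
  case (Suc T)
  show ?case
  proof (cases "T * s \<le> R")
    case True
    then show ?thesis
      using Suc upt_add_eq_append[of A "A + T * s" "min (Suc T * s) R - T * s"] by (simp add: min_def)
  next
    case False
    then show ?thesis using Suc by simp
  qed
qed simp

lemma valid_layerI:
  assumes "\<And>k. k < N \<Longrightarrow> distinct (fst L k)" and "\<And>k. k < N \<Longrightarrow> length (fst L k) \<le> s"
    and "\<And>k. k < N \<Longrightarrow> set (fst L k) \<subseteq> {..<N}"
    and "\<And>l. card {k. k < N \<and> l \<in> set (fst L k)} \<le> 2" and "2 \<le> s"
  shows "valid_layer N s L"
proof -
  have "card {k. k < N \<and> l \<in> set (fst L k)} \<le> s" for l
    using assms(4)[of l] assms(5) by linarith
  then show ?thesis using assms(1-3) by (simp add: valid_layer_def)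
qed

lemma layer_apply_less: "0 < N \<Longrightarrow> layer_apply N L V k < N"
  by (simp add: layer_apply_def)

lemma run_less:
  assumes "\<And>k. V k < N"
  shows "run N P V k < N"
proof -
  have "0 < N" using assms[of 0] by simp
  then show ?thesis
    using assms by (induction P arbitrary: V) (simp_all add: layer_apply_less)
qed

text \<open>The dimension n is padded to a power F of the tree degree. \<open>N_nodes\<close> makes
  room for computation and storage nodes, \<open>N_sums\<close> keeps sums of F residues below N,
  and \<open>T\<close> layers write the \<open>R\<close> residues in portions of
  \<open>s\<close>.\<close>

locale shift_circuit =
  fixes n f D F N s R T m0 i j :: nat and a b :: int
  assumes F: "F = f ^ D" and n_F: "n \<le> F" and f: "2 \<le> f" "f \<le> s"
    and N_nodes: "2 * F ^ 3 \<le> N" and N_sums: "F * (m0 + F) \<le> N"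
    and m0: "0 < m0" and ij: "i < n" "j < n" "i \<noteq> j" and R: "R \<le> F" "R \<le> T * s"
begin

text \<open>Node \<open>k\<close> below \<open>base\<close> is \<open>(h F + v) F + u\<close>: the entry \<open>(v, u)\<close> of the computation modulo
  \<open>m0 + h\<close>. The nodes from \<open>base\<close> on are storage; during the iteration node
  \<open>base + k\<close> holds the adjacency bit of \<open>{v, u}\<close>.\<close>

definition base :: nat where
  "base = F ^ 3"

definition modulus :: "nat \<Rightarrow> int" where
  "modulus h = int (m0 + h)"

text \<open>One level of a tree in which \<open>k div f\<close> is the parent of \<open>k\<close>;
  after D levels node \<open>k\<close> holds the value of node \<open>k div F\<close>.\<close>

definition broadcast :: layer where
  "broadcast = (\<lambda>k. [if k < base then k div f else k], \<lambda>k xs. hd xs)"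

text \<open>The same tree towards the root: D levels put into node \<open>k\<close> the sum over the
  block of length F that starts at \<open>k * F\<close>.\<close>

definition reduce :: layer where
  "reduce = (\<lambda>k. if base \<le> k then [k] else if k * f + f \<le> base then [k * f..<k * f + f] else [],
     \<lambda>k xs. sum_list xs)"

text \<open>The preceding broadcast has made F copies of each edge bit. Copy \<open>h\<close> goes
  to the storage nodes of (v, u) and (u, v) for modulus \<open>h\<close>, while the computation
  nodes receive the start vector.\<close>

definition setup_layer :: layer where
  "setup_layer = (\<lambda>k. if k < base then [] else
       let x = k - base; h = x div F div F; v = x div F mod F; u = x mod F
       in if h < F \<and> u < n \<and> v < n then [(min u v * n + max u v) * F + h] else [],
     \<lambda>k xs. if k < base
       then nat ((of_bool (k mod F = i) - of_bool (k mod F = j)) mod modulus (k div F))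
       else if xs = [] then 0 else hd xs)"

text \<open>After a broadcast, entry u of the vector fills row u; node (v, u) fetches it from the
  transposed node (u, v), which keeps the fan-out at two. Padding columns yield 0.\<close>

definition multiply :: layer where
  "multiply = (\<lambda>k. if k < base
       then [(k div F div F * F + k mod F) * F + k div F mod F, base + k] else [k],
     \<lambda>k xs. if k < base
       then if k mod F < n
         then nat (((b * int (xs ! 1) - a) * int (xs ! 0)) mod modulus (k div F div F)) else 0
       else hd xs)"

definition subtract :: layer where
  "subtract = (\<lambda>k. if base \<le> k \<and> k < base + F then [(k - base) * F + i, (k - base) * F + j] else [],
     \<lambda>k xs. nat ((int (xs ! 0) - int (xs ! 1)) mod modulus (k - base)))"

text \<open>The point is the list of predecessors of node 0: their values are what machine 0 holds
  in memory and writes.\<close>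

definition collect :: "nat \<Rightarrow> layer" where
  "collect c = (\<lambda>k. if base \<le> k then [k]
       else if k = 0 then [base + c * s..<base + min (Suc c * s) R] else [],
     \<lambda>k xs. if xs = [] then 0 else hd xs)"

definition iteration :: "layer list" where
  "iteration = replicate D broadcast @ multiply # replicate D reduce"

definition main_program :: "nat \<Rightarrow> layer list" where
  "main_program t = replicate D broadcast @ setup_layer # concat (replicate t iteration) @ [subtract]"

definition program :: "nat \<Rightarrow> layer list" where
  "program t = main_program t @ map collect [0..<T]"

lemma length_main_program: "length (main_program t) = D + t * (2 * D + 1) + 2"
  by (induction t) (auto simp: main_program_def iteration_def)

lemma length_program: "length (program t) = D + t * (2 * D + 1) + 2 + T"
  by (simp add: program_def length_main_program)

section \<open>Node addresses\<close>

lemma F_pos: "0 < F"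
  using ij n_F by simp

lemma N_ge: "2 * base \<le> N" "2 \<le> N"
proof -
  show *: "2 * base \<le> N" using N_nodes by (simp add: base_def)
  have "1 \<le> base" using F_pos by (simp add: base_def)
  then show "2 \<le> N" using * by linarith
qed

lemma node_less_base:
  assumes "h < F" "v < F" "u < F"
  shows "(h * F + v) * F + u < base"
  using mixed_radix_less[OF mixed_radix_less[OF assms(1,2)] assms(3)]
  by (simp add: base_def power3_eq_cube)

lemma node_digits:
  assumes "u < F" and "v < F"
  shows "((h * F + v) * F + u) div F div F = h" "((h * F + v) * F + u) div F mod F = v"
    "((h * F + v) * F + u) mod F = u"
  using assms by auto

lemma div_base_less: "k < base \<Longrightarrow> k div F div F < F"
  by (simp add: base_def div_mult2_eq[symmetric] less_mult_imp_div_less power3_eq_cube mult.assoc)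

lemma node_recompose: "(k div F div F * F + k div F mod F) * F + k mod F = (k::nat)"
  by simp

section \<open>Fan-in and fan-out of the layers\<close>

lemma valid_broadcast: "valid_layer N s broadcast"
proof -
  have "card {k. k < N \<and> l = (if k < base then k div f else k)} \<le> s" if "l < N" for l
  proof -
    \<comment> \<open>The readers of a computation node are its \<open>f\<close> children in the
      tree.\<close>
    have "{k. k < N \<and> l = (if k < base then k div f else k)} \<subseteq>
      (if l < base then {l * f..<l * f + f} else {l})"
    proof
      fix k assume k: "k \<in> {k. k < N \<and> l = (if k < base then k div f else k)}"
      show "k \<in> (if l < base then {l * f..<l * f + f} else {l})"
      proof (cases "k < base")
        case True
        then have "l = k div f" using k by simp
        moreover then have "l < base" using True div_le_dividend[of k f] by linarith
        moreover have "k mod f < f" using f by simp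
        then have "k div f * f \<le> k" "k < k div f * f + f"
          using div_mult_mod_eq[of k f] by linarith+
        ultimately show ?thesis by simp
      qed (use k in auto)
    qed
    then have "card {k. k < N \<and> l = (if k < base then k div f else k)} \<le>
      card (if l < base then {l * f..<l * f + f} else {l})"
      by (intro card_mono) auto
    also have "\<dots> \<le> s" using f by simp
    finally show ?thesis .
  qed
  moreover have "k div f < N" if "k < N" for k
    using that div_le_dividend[of k f] by linarith
  ultimately show ?thesis
    using f by (auto simp: valid_layer_def broadcast_def)
qed

lemma valid_reduce: "valid_layer N s reduce"
proof -
  have "card {k. k < N \<and> l \<in> set (fst reduce k)} \<le> s" for l
  proof -
    have "{k. k < N \<and> l \<in> set (fst reduce k)} \<subseteq> {if l < base then l div f else l}"
    proof
      fix k assume k: "k \<in> {k. k < N \<and> l \<in> set (fst reduce k)}"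
      show "k \<in> {if l < base then l div f else l}"
      proof (cases "base \<le> k")
        case False
        then have "k * f \<le> l" "l < k * f + f" "k * f + f \<le> base"
          using k by (auto simp: reduce_def split: if_splits)
        moreover then have "l div f = k"
          by (intro div_nat_eqI) (auto simp: mult.commute)
        ultimately show ?thesis by simp
      qed (use k in \<open>auto simp: reduce_def\<close>)
    qed
    then have "card {k. k < N \<and> l \<in> set (fst reduce k)} \<le> card {if l < base then l div f else l}"
      by (intro card_mono) auto
    then show ?thesis using f by simp
  qed
  then show ?thesis
    using f N_ge by (auto simp: valid_layer_def reduce_def)
qed

lemma valid_setup_layer: "valid_layer N s setup_layer"
proof -
  have src: "\<exists>h u v. h < F \<and> u < n \<and> v < n \<and> k = base + (h * F + v) * F + u \<and>
      l = (min u v * n + max u v) * F + h" if "l \<in> set (fst setup_layer k)" for k l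
  proof -
    define x where "x = k - base"
    have "k = base + x" using that by (auto simp: setup_layer_def x_def split: if_splits)
    then show ?thesis
      using that
      by (intro exI[of _ "x div F div F"] exI[of _ "x mod F"] exI[of _ "x div F mod F"])
        (auto simp: setup_layer_def Let_def add.assoc node_recompose split: if_splits)
  qed
  have "card {k. k < N \<and> l \<in> set (fst setup_layer k)} \<le> 2" for l
  proof -
    define h where "h = l mod F"
    define p where "p = l div F div n"
    define p' where "p' = l div F mod n"
    \<comment> \<open>\<open>l\<close> determines the copy number and the unordered pair, which
      leaves two orders.\<close>
    have "{k. k < N \<and> l \<in> set (fst setup_layer k)} \<subseteq>
      {base + (h * F + p) * F + p', base + (h * F + p') * F + p}"
    proof
      fix k assume "k \<in> {k. k < N \<and> l \<in> set (fst setup_layer k)}"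
      then obtain h' u v where *: "h' < F" "u < n" "v < n" "k = base + (h' * F + v) * F + u"
        "l = (min u v * n + max u v) * F + h'" using src by blast
      then have "h = h'" "p = min u v" "p' = max u v"
        by (auto simp: h_def p_def p'_def)
      then show "k \<in> {base + (h * F + p) * F + p', base + (h * F + p') * F + p}"
        using * by (auto simp: min_def max_def)
    qed
    then show ?thesis by (rule card_le_if_subset_pair)
  qed
  moreover have "l < N" if l: "l \<in> set (fst setup_layer k)" for k l
  proof -
    obtain h u v where *: "h < F" "u < n" "v < n" "k = base + (h * F + v) * F + u"
      "l = (min u v * n + max u v) * F + h" using src l by blast
    have "min u v * n + max u v < n * n" using * by (intro mixed_radix_less) auto
    also have "\<dots> \<le> F * F" using n_F by (intro mult_mono) auto
    finally have "l < F * F * F" unfolding *(5) using *(1) by (rule mixed_radix_less)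
    then show ?thesis using N_ge by (simp add: base_def power3_eq_cube)
  qed
  moreover have "distinct (fst setup_layer k) \<and> length (fst setup_layer k) \<le> 1" for k
    by (auto simp: setup_layer_def Let_def)
  ultimately show ?thesis
    using f by (intro valid_layerI) (auto intro: le_trans[of _ 1 s])
qed

lemma valid_multiply: "valid_layer N s multiply"
proof -
  \<comment> \<open>Transposition is an involution, so each computation node is fetched by only one
    node.\<close>
  define swap where "swap k = (k div F div F * F + k mod F) * F + k div F mod F" for k
  have swap_less: "swap k < base" if "k < base" for k
    using that F_pos div_base_less by (auto simp: swap_def intro!: node_less_base)
  have swap_swap: "swap (swap k) = k" for k
    using F_pos by (simp add: swap_def node_digits node_recompose)
  have src: "fst multiply k = (if k < base then [swap k, base + k] else [k])" for k
    by (simp add: multiply_def swap_def)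
  have "card {k. k < N \<and> l \<in> set (fst multiply k)} \<le> 2" for l
  proof -
    have "{k. k < N \<and> l \<in> set (fst multiply k)} \<subseteq> {if l < base then swap l else l, l - base}"
      using swap_swap swap_less by (auto simp: src split: if_splits)
    then show ?thesis by (rule card_le_if_subset_pair)
  qed
  moreover have "set (fst multiply k) \<subseteq> {..<N}" "distinct (fst multiply k)"
    "length (fst multiply k) \<le> 2" if "k < N" for k
    using that swap_less[of k] N_ge by (auto simp: src)
  ultimately show ?thesis
    using f by (intro valid_layerI) (auto intro: le_trans[of _ 2 s])
qed

lemma valid_subtract: "valid_layer N s subtract"
proof -
  have lt: "h * F + u < N" if "h < F" "u < n" for h u
  proof -
    have "h * F + u < F * F" using that n_F by (intro mixed_radix_less) auto
    also have "\<dots> \<le> F * F * F" using F_pos by simp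
    finally show ?thesis using N_ge by (simp add: base_def power3_eq_cube)
  qed
  have "card {k. k < N \<and> l \<in> set (fst subtract k)} \<le> 2" for l
  proof -
    \<comment> \<open>There is a single reader; it is listed twice to fit the lemma on
      pairs.\<close>
    have "{k. k < N \<and> l \<in> set (fst subtract k)} \<subseteq> {base + l div F, base + l div F}"
      using ij n_F by (auto simp: subtract_def split: if_splits)
    then show ?thesis by (rule card_le_if_subset_pair)
  qed
  moreover have "set (fst subtract k) \<subseteq> {..<N}" "distinct (fst subtract k)"
    "length (fst subtract k) \<le> 2" if "k < N" for k
    using lt[of "k - base"] ij by (auto simp: subtract_def)
  ultimately show ?thesis
    using f by (intro valid_layerI) (auto intro: le_trans[of _ 2 s])
qed

lemma F_le_base: "F \<le> base"
  using F_pos by (simp add: base_def power3_eq_cube)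

lemma valid_collect: "valid_layer N s (collect c)"
proof -
  have "card {k. k < N \<and> l \<in> set (fst (collect c) k)} \<le> 2" for l
  proof -
    have "{k. k < N \<and> l \<in> set (fst (collect c) k)} \<subseteq> {l, 0}"
      by (auto simp: collect_def split: if_splits)
    then show ?thesis by (rule card_le_if_subset_pair)
  qed
  moreover have "set (fst (collect c) k) \<subseteq> {..<N}" "distinct (fst (collect c) k)"
    "length (fst (collect c) k) \<le> s" if "k < N" for k
    using that f R F_le_base N_ge by (auto simp: collect_def)
  ultimately show ?thesis
    using f by (intro valid_layerI) auto
qed

lemma valid_program: "\<forall>L \<in> set (program t). valid_layer N s L"
  using valid_broadcast valid_reduce valid_setup_layer valid_multiply valid_subtract valid_collect
  by (auto simp: program_def main_program_def iteration_def)

section \<open>Values computed by the layers\<close>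

lemma run_broadcast:
  assumes "\<And>k. V k < N"
  shows "run N (replicate d broadcast) V k = V (if k < base then k div f ^ d else k)"
  using assms
proof (induction d arbitrary: V)
  case (Suc d)
  have "layer_apply N broadcast V k = V (if k < base then k div f else k)" for k
    using Suc.prems by (simp add: layer_apply_def broadcast_def)
  moreover have "k div f ^ d < base" if "k < base"
    using that div_le_dividend[of k "f ^ d"] by linarith
  ultimately show ?case
    using Suc N_ge by (simp add: layer_apply_less div_mult2_eq[symmetric] mult.commute)
qed simp

text \<open>Groups of \<open>f\<close> sums over blocks of length \<open>f ^ d\<close> join to one
  longer block, and reducing modulo N at inner nodes does not change the result modulo N. The
  condition on \<open>k\<close> says that its block lies among the computation nodes.\<close>

lemma run_reduce:
  assumes "\<And>k. V k < N"
  shows "base \<le> k \<Longrightarrow> run N (replicate d reduce) V k = V k"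
    and "(k + 1) * f ^ d \<le> base \<Longrightarrow>
      run N (replicate d reduce) V k = (\<Sum>y<f ^ d. V (k * f ^ d + y)) mod N"
proof -
  show "run N (replicate d reduce) V k = V k" if "base \<le> k"
    using assms that
  proof (induction d arbitrary: V)
    case (Suc d)
    then show ?case using N_ge by (simp add: layer_apply_less) (simp add: layer_apply_def reduce_def)
  qed simp
  show "run N (replicate d reduce) V k = (\<Sum>y<f ^ d. V (k * f ^ d + y)) mod N"
    if "(k + 1) * f ^ d \<le> base"
    using assms that
  proof (induction d arbitrary: V)
    case (Suc d)
    let ?A = "f ^ d"
    have le: "(k * ?A + y) * f + f \<le> base" if "y < ?A" for y
    proof -
      have "k * ?A + y + 1 \<le> (k + 1) * ?A" using that by simp
      then have "(k * ?A + y + 1) * f \<le> (k + 1) * ?A * f" by (rule mult_right_mono) simp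
      then show ?thesis using Suc.prems(2) by (simp add: algebra_simps)
    qed
    have "k * ?A + y < base" if "y < ?A" for y
    proof -
      have "k * ?A + y \<le> (k * ?A + y) * f" using f by simp
      then show ?thesis using le[OF that] f by linarith
    qed
    then have not_base: "\<not> base \<le> k * ?A + y" if "y < ?A" for y
      using that by (simp add: not_le)
    have layer: "layer_apply N reduce V (k * ?A + y) =
        (\<Sum>c\<in>{(k * ?A + y) * f..<(k * ?A + y) * f + f}. V c) mod N" if "y < ?A" for y
      using le[OF that] not_base[OF that]
      by (simp add: layer_apply_def reduce_def interv_sum_list_conv_sum_set_nat)
    have "?A \<le> f ^ Suc d" using f by simp
    then have "(k + 1) * ?A \<le> (k + 1) * f ^ Suc d" by (rule mult_left_mono) simp
    then have "(k + 1) * ?A \<le> base" using Suc.prems(2) by linarith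
    then have "run N (replicate (Suc d) reduce) V k =
        (\<Sum>y<?A. layer_apply N reduce V (k * ?A + y)) mod N"
      using Suc.IH[of "layer_apply N reduce V"] N_ge by (simp add: layer_apply_less)
    also have "\<dots> = (\<Sum>y<?A. \<Sum>c\<in>{(k * ?A + y) * f..<(k * ?A + y) * f + f}. V c) mod N"
      using layer by (simp add: mod_sum_eq)
    also have "(\<Sum>y<?A. \<Sum>c\<in>{(k * ?A + y) * f..<(k * ?A + y) * f + f}. V c) =
        (\<Sum>y<?A. \<Sum>c\<in>{y * f..<y * f + f}. V (k * f ^ Suc d + c))"
    proof (rule sum.cong[OF refl])
      fix y
      show "(\<Sum>c\<in>{(k * ?A + y) * f..<(k * ?A + y) * f + f}. V c) =
        (\<Sum>c\<in>{y * f..<y * f + f}. V (k * f ^ Suc d + c))"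
        using sum.shift_bounds_nat_ivl[of V "y * f" "k * f ^ Suc d" "y * f + f"]
        by (simp add: algebra_simps)
    qed
    also have "\<dots> = (\<Sum>y<f ^ Suc d. V (k * f ^ Suc d + y))"
      by (simp add: sum.nat_group mult.commute)
    finally show ?case .
  qed simp
qed

text \<open>Vector entries are known only up to congruence, since a step leaves unreduced sums of
  residues; padding coordinates stay unspecified.\<close>

definition iterate_inv :: "nat set set \<Rightarrow> nat \<Rightarrow> (nat \<Rightarrow> nat) \<Rightarrow> bool" where
  "iterate_inv E t V \<longleftrightarrow> (\<forall>k. V k < N) \<and>
     (\<forall>h<F. \<forall>v<n. \<forall>u<n. V (base + (h * F + v) * F + u) = of_bool ({v, u} \<in> E)) \<and>
     (\<forall>h<F. \<forall>u<n. int (V (h * F + u)) mod modulus h = shift_iter n E a b i j t u mod modulus h)"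

lemma modulus_pos: "0 < modulus h"
  using m0 by (simp add: modulus_def)

lemma residue_less:
  assumes "h < F"
  shows "nat (z mod modulus h) < m0 + F" "nat (z mod modulus h) < N"
proof -
  have "z mod modulus h < modulus h" using modulus_pos by simp
  then have "z mod modulus h < int (m0 + F)" using assms by (simp add: modulus_def)
  then show *: "nat (z mod modulus h) < m0 + F"
    using modulus_pos[of h] by (simp add: nat_less_iff)
  have "m0 + F \<le> F * (m0 + F)" using F_pos by simp
  then show "nat (z mod modulus h) < N" using * N_sums by linarith
qed

lemma int_nat_residue: "int (nat (z mod modulus h)) = z mod modulus h"
  using modulus_pos[of h] by simp

lemma run_setup:
  assumes "graph_on n E"
  shows "iterate_inv E 0 (run N (replicate D broadcast @ [setup_layer]) (edge_bit n E))"
proof -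
  define V where "V = run N (replicate D broadcast) (edge_bit n E)"
  have V: "V k = edge_bit n E (if k < base then k div F else k)" for k
    unfolding V_def using run_broadcast[of "edge_bit n E" D k] N_ge by (simp add: F edge_bit_def)
  have bit: "edge_bit n E (min u v * n + max u v) = of_bool ({v, u} \<in> E)" if "u < n" "v < n" for u v
  proof -
    have "min u v * n + max u v \<in> edge_words n E \<longleftrightarrow> {v, u} \<in> E"
    proof
      assume "min u v * n + max u v \<in> edge_words n E"
      then obtain u' v' where *: "min u v * n + max u v = u' * n + v'" "u' < v'" "v' < n" "{u', v'} \<in> E"
        by (auto simp: edge_words_def)
      have "min u v = (min u v * n + max u v) div n" using that by simp
      also have "\<dots> = u'" unfolding *(1) using * by simp
      finally have "min u v = u'" .
      moreover then have "max u v = v'" using *(1) by simp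
      ultimately have "{u', v'} = {v, u}" by (auto simp: min_def max_def split: if_splits)
      then show "{v, u} \<in> E" using * by simp
    next
      assume E: "{v, u} \<in> E"
      \<comment> \<open>Edge words have \<open>u < v\<close>, so the equivalence depends on the
        absence of loops.\<close>
      then have "u \<noteq> v" using assms by (auto simp: graph_on_def doubleton_eq_iff)
      then show "min u v * n + max u v \<in> edge_words n E"
        using E that unfolding edge_words_def
        by (intro CollectI exI[of _ "min u v"] exI[of _ "max u v"])
          (auto simp: min_def max_def insert_commute)
    qed
    then show ?thesis by (simp add: edge_bit_def)
  qed
  define V' where "V' = layer_apply N setup_layer V"
  have "V' k < N" for k using N_ge by (simp add: V'_def layer_apply_less)
  moreover have "V' (base + (h * F + v) * F + u) = of_bool ({v, u} \<in> E)"
    if *: "h < F" "v < n" "u < n" for h v u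
  proof -
    let ?l = "(min u v * n + max u v) * F + h"
    have "min u v * n + max u v < n * n" using * by (intro mixed_radix_less) auto
    also have "\<dots> \<le> F * F" using n_F by (intro mult_mono) auto
    finally have "?l < base"
      using mixed_radix_less[of "min u v * n + max u v" "F * F" h F] * by (simp add: base_def power3_eq_cube)
    then have "V ?l = of_bool ({v, u} \<in> E)"
      using V[of ?l] bit[of u v] * by simp
    then show ?thesis
      using * n_F N_ge unfolding V'_def layer_apply_def
      by (simp add: setup_layer_def Let_def add.assoc node_digits)
  qed
  moreover have "int (V' (h * F + u)) mod modulus h = shift_iter n E a b i j 0 u mod modulus h"
    if *: "h < F" "u < n" for h u
  proof -
    have "h * F + u < base" using node_less_base[of 0 h u] * n_F F_pos by simp
    then have "V' (h * F + u) = nat ((of_bool (u = i) - of_bool (u = j)) mod modulus h) mod N"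
      using * n_F by (simp add: V'_def layer_apply_def setup_layer_def)
    then show ?thesis
      using residue_less(2)[OF *(1)] by (simp add: int_nat_residue del: int_nat_eq)
  qed
  ultimately show ?thesis
    by (simp add: iterate_inv_def V'_def V_def)
qed

lemma run_iteration:
  assumes "iterate_inv E t V"
  shows "iterate_inv E (Suc t) (run N iteration V)"
proof -
  have V: "\<And>k. V k < N"
    and bits: "\<And>h v u. h < F \<Longrightarrow> v < n \<Longrightarrow> u < n \<Longrightarrow>
      V (base + (h * F + v) * F + u) = of_bool ({v, u} \<in> E)"
    and vec: "\<And>h u. h < F \<Longrightarrow> u < n \<Longrightarrow>
      int (V (h * F + u)) mod modulus h = shift_iter n E a b i j t u mod modulus h"
    using assms by (auto simp: iterate_inv_def)
  define V1 where "V1 = run N (replicate D broadcast) V"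
  define V2 where "V2 = layer_apply N multiply V1"
  define V3 where "V3 = run N (replicate D reduce) V2"
  have V1: "V1 k = V (if k < base then k div F else k)" for k
    using run_broadcast[of V D k] V by (simp add: V1_def F)
  have V2_less: "V2 k < N" for k using N_ge by (simp add: V2_def layer_apply_less)
  have V2_store: "V2 k = V k" if "base \<le> k" for k
    using that V[of k] by (simp add: V2_def layer_apply_def multiply_def V1)
  have V2: "V2 ((h * F + v) * F + u) = (if u < n then
      nat ((b * int (V (base + (h * F + v) * F + u)) - a) * int (V (h * F + u)) mod modulus h) else 0)"
    if *: "h < F" "v < F" "u < F" for h v u
    using node_less_base[OF *] node_less_base[OF *(1,3,2)] residue_less(2)[OF *(1)] * 
    by (simp add: V2_def layer_apply_def multiply_def node_digits V1 add.assoc)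
  have "V3 (base + (h * F + v) * F + u) = of_bool ({v, u} \<in> E)" if "h < F" "v < n" "u < n" for h v u
    using run_reduce(1)[of V2 _ D] V2_less V2_store bits[OF that] by (simp add: V3_def)
  moreover have "V3 k < N" for k
    by (simp add: V3_def V2_less run_less)
  moreover have "int (V3 (h * F + v)) mod modulus h = shift_iter n E a b i j (Suc t) v mod modulus h"
    if *: "h < F" "v < n" for h v
  proof -
    have "(h * F + v + 1) * F \<le> F * F * F"
      using mixed_radix_less[of h F v F] * n_F by (intro mult_right_mono) auto
    then have V3: "V3 (h * F + v) = (\<Sum>u<F. V2 ((h * F + v) * F + u)) mod N"
      using run_reduce(2)[of V2 "h * F + v" D] V2_less by (simp add: V3_def F[symmetric] base_def power3_eq_cube)
    \<comment> \<open>F such residues add up to less than N, so the sum is not altered by the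
      reduction modulo N.\<close>
    have "V2 ((h * F + v) * F + u) < m0 + F" if "u < F" for u
      using V2[of h v u] residue_less(1)[OF *(1)] * n_F that F_pos by simp
    then have "(\<Sum>u<F. V2 ((h * F + v) * F + u)) < (\<Sum>u<F. m0 + F)"
      using F_pos by (intro sum_strict_mono) auto
    also have "\<dots> \<le> N" using N_sums by simp
    finally have "V3 (h * F + v) = (\<Sum>u<F. V2 ((h * F + v) * F + u))"
      using V3 by simp
    also have "\<dots> = (\<Sum>u<n. V2 ((h * F + v) * F + u))"
      using n_F * V2[of h v] by (intro sum.mono_neutral_right) auto
    finally have "int (V3 (h * F + v)) =
      (\<Sum>u<n. (b * of_bool ({v, u} \<in> E) - a) * int (V (h * F + u)) mod modulus h)"
      using V2[of h v] * n_F bits by (simp add: int_nat_residue del: int_nat_eq)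
    also have "\<dots> = (\<Sum>u<n. (b * of_bool ({v, u} \<in> E) - a) * shift_iter n E a b i j t u mod modulus h)"
      using vec[OF *(1)] by (intro sum.cong mod_mult_cong refl) auto
    finally show ?thesis by (simp add: mod_sum_eq)
  qed
  ultimately show ?thesis
    by (simp add: iterate_inv_def iteration_def V1_def V2_def V3_def)
qed

lemma run_main_program:
  assumes "graph_on n E" and "h < F"
  shows "run N (main_program t) (edge_bit n E) (base + h) =
    nat (shift_form n E a b i j t mod modulus h)"
proof -
  define V where "V = run N (replicate D broadcast @ setup_layer # concat (replicate t iteration)) (edge_bit n E)"
  have "iterate_inv E t (run N (concat (replicate t iteration)) V)" if "iterate_inv E 0 V" for V
  proof -
    \<comment> \<open>The induction needs the new copy at the end, where it is run last.\<close>
    have "concat (replicate (Suc t) iteration) = concat (replicate t iteration) @ iteration" for t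
      by (simp flip: replicate_append_same)
    then show ?thesis using that by (induction t) (simp_all add: run_iteration del: replicate_Suc)
  qed
  then have "iterate_inv E t V"
    using run_setup[OF assms(1)] by (simp add: V_def)
  then have "int (V (h * F + u)) mod modulus h = shift_iter n E a b i j t u mod modulus h" if "u < n" for u
    using assms(2) that by (auto simp: iterate_inv_def)
  then have "(int (V (h * F + i)) - int (V (h * F + j))) mod modulus h = shift_form n E a b i j t mod modulus h"
    unfolding shift_form_def using ij by (intro mod_diff_cong) auto
  moreover have "run N (main_program t) (edge_bit n E) (base + h) =
    nat ((int (V (h * F + i)) - int (V (h * F + j))) mod modulus h) mod N"
    using assms(2) by (simp add: main_program_def V_def layer_apply_def[of _ subtract]) (simp add: subtract_def)
  ultimately show ?thesis
    using residue_less(2)[OF assms(2)] by simp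
qed

lemma run_collect:
  assumes "\<And>k. V k < N" and "base \<le> k"
  shows "run N (map collect cs) V k = V k"
  using assms
proof (induction cs arbitrary: V)
  case (Cons c cs)
  then show ?case using N_ge by (simp add: layer_apply_less) (simp add: layer_apply_def collect_def)
qed simp

lemma program_correct:
  fixes dec :: "nat list \<Rightarrow> real" and t :: nat
  assumes "edge_distribution n E N s input" and "graph_on n E"
  defines "\<A> \<equiv> layered_algorithm N (program t) (length (main_program t)) dec"
  shows "within_space N s \<A> input"
    and "mpc_output \<A> N input = map (\<lambda>h. nat (shift_form n E a b i j t mod modulus h)) [0..<R]"
proof -
  have s: "1 \<le> s" using f by simp
  have len: "length (main_program t) \<le> length (program t)" by (simp add: program_def)
  note correct = layered_algorithm_correct[OF assms(1) valid_program N_ge(2) s len, of dec, folded \<A>_def]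
  show "within_space N s \<A> input" by (rule correct)
  let ?M = "length (main_program t)"
  let ?V = "run N (main_program t) (edge_bit n E)"
  have V: "?V k < N" for k
    using N_ge by (simp add: main_program_def layer_apply_less)
  have "mpc_output \<A> N input = concat (map (\<lambda>p. map (run N (take p (program t)) (edge_bit n E))
      (fst (program t ! p) 0)) [?M..<?M + T])"
    using correct(2) by (simp add: program_def)
  also have "\<dots> = concat (map (\<lambda>c. map (run N (take (?M + c) (program t)) (edge_bit n E))
      (fst (program t ! (?M + c)) 0)) [0..<T])"
    by (simp add: map_add_upt[symmetric] o_def add.commute)
  \<comment> \<open>Collecting leaves the storage nodes intact, so each portion is read from the
    state after the main program.\<close>
  also have "\<dots> = concat (map (\<lambda>c. map ?V [base + c * s..<base + min (Suc c * s) R]) [0..<T])"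
  proof (rule arg_cong[where f = concat], rule map_cong[OF refl])
    fix c assume "c \<in> set [0..<T]"
    then have "take (?M + c) (program t) = main_program t @ map collect [0..<c]"
      "program t ! (?M + c) = collect c"
      by (auto simp: program_def take_map nth_append)
    moreover have "fst (collect c) 0 = [base + c * s..<base + min (Suc c * s) R]"
      using F_le_base F_pos by (simp add: collect_def)
    ultimately show "map (run N (take (?M + c) (program t)) (edge_bit n E)) (fst (program t ! (?M + c)) 0) =
        map ?V [base + c * s..<base + min (Suc c * s) R]"
      using V by (auto simp: run_collect)
  qed
  also have "\<dots> = map ?V (concat (map (\<lambda>c. [base + c * s..<base + min (Suc c * s) R]) [0..<T]))"
    by (simp only: map_concat map_map o_def)
  also have "\<dots> = map ?V [base..<base + R]"
    unfolding concat_chunks using R by simp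
  also have "\<dots> = map (\<lambda>h. ?V (base + h)) [0..<R]"
    by (simp add: map_add_upt[symmetric] o_def add.commute)
  also have "\<dots> = map (\<lambda>h. nat (shift_form n E a b i j t mod modulus h)) [0..<R]"
    using R run_main_program[OF assms(2)] by simp
  finally show "mpc_output \<A> N input = map (\<lambda>h. nat (shift_form n E a b i j t mod modulus h)) [0..<R]" .
qed

end

section \<open>Choice of the parameters\<close>

text \<open>The bound \<open>n ^ 2\<close> on the padded dimension keeps the exponent of the number
  of machines constant.\<close>

lemma tree_parameters:
  assumes "2 \<le> n" and "2 \<le> s" and D: "D = nat \<lceil>log (real s) (real n)\<rceil>"
  obtains f where "2 \<le> f" "f \<le> s" "n \<le> f ^ D" "f ^ D \<le> n ^ 2" "1 \<le> D"
proof -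
  have pos: "0 < log (real s) (real n)" using assms by simp
  then have "0 < \<lceil>log (real s) (real n)\<rceil>" by (simp add: zero_less_ceiling)
  then have D1: "1 \<le> D" and D_real: "real D = real_of_int \<lceil>log (real s) (real n)\<rceil>"
    using D by (simp_all del: zero_less_ceiling)
  have s_powr: "real s powr log (real s) (real n) = real n" using assms by simp
  show thesis
  proof (cases "n \<le> s")
    case True
    then have "log (real s) (real n) \<le> 1" using assms by simp
    then have "\<lceil>log (real s) (real n)\<rceil> \<le> 1" by (simp add: ceiling_le_iff)
    then have "D = 1" using D1 D by linarith
    \<comment> \<open>The degree is n here, as \<open>s\<close> itself may exceed
      \<open>n ^ 2\<close>.\<close>
    then show thesis using that[of n] True assms by (simp add: power2_eq_square)
  next
    case False
    have "log (real s) (real n) \<le> real D" using D_real by simp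
    then have "real n \<le> real s powr real D"
      using assms(2) by (subst s_powr[symmetric]) (simp add: powr_mono)
    then have le: "n \<le> s ^ D" using assms(2) by (simp add: powr_realpow flip: of_nat_power)
    have "real D < log (real s) (real n) + 1" using D_real by linarith
    then have "real (D - 1) < log (real s) (real n)" using D1 by simp
    then have "real s powr real (D - 1) < real n"
      using assms(2) by (subst s_powr[symmetric]) simp
    then have "s ^ (D - 1) < n" using assms(2) by (simp add: powr_realpow flip: of_nat_power)
    then have "s * s ^ (D - 1) \<le> n * n" using False by (intro mult_mono) auto
    then have "s ^ D \<le> n ^ 2" using D1 by (simp add: power2_eq_square flip: power_Suc)
    then show thesis using that[of s] assms(2) le D1 by simp
  qed
qed

text \<open>The factor 2 on the left prepares for comparing two values; the exponent 3 absorbs the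
  constant 8.\<close>

lemma abs_shift_form_less:
  fixes a b :: int
  assumes "2 \<le> n" and "0 \<le> a" and "0 \<le> b" and "int n * (a + b) \<le> int n ^ p"
  shows "2 * \<bar>shift_form n E a b i j t\<bar> < int n ^ (p * t + 3)"
proof -
  have "\<bar>shift_iter n E a b i j t v\<bar> \<le> int n ^ (p * t)" for v
  proof -
    have "(int n * (a + b)) ^ t \<le> (int n ^ p) ^ t" using assms by (intro power_mono) auto
    then show ?thesis
      using abs_shift_iter_le[of a b n E i j t v] assms by (simp add: power_mult)
  qed
  moreover have "\<bar>x - y\<bar> \<le> 2 * B" if "\<bar>x\<bar> \<le> B" "\<bar>y\<bar> \<le> B" for x y B :: int
    using that by linarith
  ultimately have "\<bar>shift_form n E a b i j t\<bar> \<le> 2 * int n ^ (p * t)"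
    unfolding shift_form_def by blast
  then have "2 * \<bar>shift_form n E a b i j t\<bar> \<le> 4 * int n ^ (p * t)" by linarith
  also have "\<dots> < 8 * int n ^ (p * t)" using assms by simp
  also have "\<dots> \<le> int n ^ 3 * int n ^ (p * t)"
    using power_mono[of 2 "int n" 3] assms by (intro mult_right_mono) auto
  finally show ?thesis by (simp add: power_add mult.commute)
qed

lemma shift_form_fraction:
  fixes a b :: int and q :: real
  assumes "b \<noteq> 0" and "q = of_int a / of_int b"
  shows "of_int (shift_form n E a b i j t) = of_int b ^ t * shift_form n E q 1 i j t"
proof -
  have "of_int a = of_int b * q" using assms by simp
  then show ?thesis
    by (simp add: shift_form_def of_int_shift_iter shift_iter_scale right_diff_distrib)
qed

section \<open>Algorithms for trivial, rational and arbitrary instances\<close>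

definition computes_norm_within ::
  "nat \<Rightarrow> nat \<Rightarrow> nat \<Rightarrow> nat \<Rightarrow> real \<Rightarrow> nat \<Rightarrow> nat \<Rightarrow> nat \<Rightarrow> mpc_algorithm \<Rightarrow> bool" where
  "computes_norm_within n N s r q i j R \<A> \<longleftrightarrow>
     (\<forall>E input. graph_on n E \<longrightarrow> edge_distribution n E N s input \<longrightarrow>
        mpc_computes N s \<A> input
          (euclidean_norm (row (shifted_adjacency n E q ^\<^sub>m r) i
                         - row (shifted_adjacency n E q ^\<^sub>m r) j)) \<and>
        length (mpc_output \<A> N input) \<le> R)"

text \<open>The norm is the same for all graphs here, so the decoder can be constant. For
  \<open>r = 0\<close> the round bound permits no communication.\<close>

lemma computes_norm_trivial:
  assumes "i < n" "j < n" "r = 0 \<or> i = j"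
  shows "\<exists>\<A>. rounds \<A> = 0 \<and> computes_norm_within n N s r q i j 0 \<A>"
proof -
  have "shift_iter n E a b i i t v = 0" for E t v and a b :: real
    by (induction t arbitrary: v) auto
  then have "shift_form n {} q 1 i j (2 * r) = shift_form n E q 1 i j (2 * r)" for E
    using assms(3) by (auto simp: shift_form_def)
  then show ?thesis
    using assms(1,2)
    by (intro exI[of _ "\<lparr>rounds = 0, message = undefined, update = undefined, emit = undefined,
        decode = \<lambda>_. sqrt (shift_form n {} q 1 i j (2 * r))\<rparr>"])
      (simp add: computes_norm_within_def mpc_computes_def within_space_def mpc_output_def norm_row_diff)
qed

text \<open>Common to all q: an integer iteration is run whose value is small enough to be found
  from \<open>R\<close> residues (\<open>bound\<close>) and determines the real form
  (\<open>det\<close>).\<close>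

lemma computes_norm_by_residues:
  fixes a b :: int and q :: real
  assumes n: "2 \<le> n" and s: "2 \<le> s" and ij: "i < n" "j < n" "i \<noteq> j" and r: "1 \<le> r"
    and R_bounds: "1 \<le> R" "R \<le> n" "R \<le> r * s"
    and det: "\<And>E E'. shift_form n E a b i j (2 * r) = shift_form n E' a b i j (2 * r) \<Longrightarrow>
      shift_form n E q 1 i j (2 * r) = shift_form n E' q 1 i j (2 * r)"
    and bound: "\<And>E. 2 * \<bar>shift_form n E a b i j (2 * r)\<bar> < int n ^ (e * R)"
  shows "\<exists>\<A>. rounds \<A> \<le> 11 * r * nat \<lceil>log (real s) (real n)\<rceil> \<and>
    computes_norm_within n (n ^ (e + 10)) s r q i j R \<A>"
proof -
  define D where "D = nat \<lceil>log (real s) (real n)\<rceil>"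
  obtain f where fan: "2 \<le> f" "f \<le> s" "n \<le> f ^ D" "f ^ D \<le> n ^ 2" "1 \<le> D"
    using tree_parameters[OF n s D_def] by blast
  define F where "F = f ^ D"
  \<comment> \<open>With \<open>F \<le> n ^ 2\<close> the nodes need \<open>n ^ 7\<close> and the
    sums \<open>n ^ (e + 5)\<close>.\<close>
  define N where "N = n ^ (e + 10)"
  have pow: "n ^ k \<le> n ^ l" if "k \<le> l" for k l using that n by (intro power_increasing) auto
  have F2: "F \<le> n ^ 2" using fan by (simp add: F_def)
  have "F ^ 3 \<le> (n ^ 2) ^ 3" using F2 by (rule power_mono) simp
  then have "2 * F ^ 3 \<le> n * n ^ 6" using n by (intro mult_mono) (auto simp flip: power_mult)
  also have "\<dots> = n ^ 7" by (simp flip: power_Suc)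
  also have "\<dots> \<le> N" using pow by (simp add: N_def)
  finally have N1: "2 * F ^ 3 \<le> N" .
  have "n ^ Suc e + F \<le> n ^ (e + 2) + n ^ (e + 2)"
    using F2 pow[of "Suc e" "e + 2"] pow[of 2 "e + 2"] by linarith
  also have "\<dots> = 2 * n ^ (e + 2)" by simp
  also have "\<dots> \<le> n * n ^ (e + 2)" using n by (rule mult_right_mono) simp
  finally have "F * (n ^ Suc e + F) \<le> n ^ 2 * (n * n ^ (e + 2))" using F2 by (intro mult_mono) auto
  also have "\<dots> = n ^ (e + 5)" by (simp add: power_add power2_eq_square power3_eq_cube numeral_eq_Suc)
  also have "\<dots> \<le> N" using pow by (simp add: N_def)
  finally have N2: "F * (n ^ Suc e + F) \<le> N" .
  define m where "m = n ^ Suc e"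
  interpret shift_circuit n f D F N s R r m i j a b
    using fan N1 N2 n ij R_bounds by unfold_locales (auto simp: F_def m_def)
  define word where "word E = map (\<lambda>h. nat (shift_form n E a b i j (2 * r) mod modulus h)) [0..<R]" for E
  have length_word: "length (word E) = R" for E by (simp add: word_def)
  \<comment> \<open>Any graph with the same residues has the same norm, so an arbitrary choice of
    such a graph decodes them.\<close>
  define dec where "dec out = sqrt (shift_form n (SOME E. word E = out) q 1 i j (2 * r))" for out
  have word_inj: "shift_form n E q 1 i j (2 * r) = shift_form n E' q 1 i j (2 * r)"
    if "word E = word E'" for E E'
  proof (rule det, rule residues_determine)
    show "1 \<le> n" "1 \<le> R" "R \<le> n" using n R_bounds by auto
    show "\<bar>shift_form n E a b i j (2 * r)\<bar> + \<bar>shift_form n E' a b i j (2 * r)\<bar> < int n ^ (e * R)"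
      using bound[of E] bound[of E'] by linarith
    fix h assume "h < R"
    then have "nat (shift_form n E a b i j (2 * r) mod modulus h) =
      nat (shift_form n E' a b i j (2 * r) mod modulus h)"
      using that by (simp add: word_def)
    then show "shift_form n E a b i j (2 * r) mod int (n ^ Suc e + h) =
      shift_form n E' a b i j (2 * r) mod int (n ^ Suc e + h)"
      unfolding m_def[symmetric] modulus_def[symmetric] by (metis int_nat_residue)
  qed
  have dec: "dec (word E) = sqrt (shift_form n E q 1 i j (2 * r))" for E
    unfolding dec_def using word_inj[of "SOME E'. word E' = word E" E] someI[of "\<lambda>E'. word E' = word E" E]
    by simp
  define \<A> where "\<A> = layered_algorithm N (program (2 * r)) (length (main_program (2 * r))) dec"
  have "rounds \<A> = D + 2 * r * (2 * D + 1) + 3 + r"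
    by (simp add: \<A>_def layered_algorithm_def length_program)
  \<comment> \<open>As r and D are at least 1, the terms contribute 1 + 4 + 3 + 3 times
    \<open>r * D\<close>.\<close>
  also have "\<dots> \<le> 11 * r * D"
  proof -
    have "D \<le> r * D" "r \<le> r * D" "1 \<le> r * D" using r fan by auto
    moreover have "D + 2 * r * (2 * D + 1) + 3 + r = D + 4 * (r * D) + 3 * r + 3"
      by (simp add: algebra_simps)
    ultimately show ?thesis by linarith
  qed
  finally have "rounds \<A> \<le> 11 * r * D" .
  moreover have "computes_norm_within n N s r q i j R \<A>"
    unfolding computes_norm_within_def
  proof (intro allI impI)
    fix E input assume E: "graph_on n E" "edge_distribution n E N s input"
    have "decode \<A> = dec" by (simp add: \<A>_def layered_algorithm_def)
    moreover have "within_space N s \<A> input" "mpc_output \<A> N input = word E"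
      using program_correct[OF E(2,1), of "2 * r" dec] by (auto simp: \<A>_def word_def)
    ultimately show "mpc_computes N s \<A> input
          (euclidean_norm (row (shifted_adjacency n E q ^\<^sub>m r) i
                         - row (shifted_adjacency n E q ^\<^sub>m r) j)) \<and>
        length (mpc_output \<A> N input) \<le> R"
      using ij length_word[of E] by (simp add: mpc_computes_def dec norm_row_diff)
  qed
  ultimately show ?thesis unfolding D_def N_def by blast
qed

text \<open>For q = a / b the integer matrix is b A - a J, and the form is rescaled by
  \<open>b ^ (2 * r)\<close>. Since \<open>R \<le> s\<close>, one portion holds all
  residues.\<close>

lemma computes_norm_fraction:
  fixes q :: real
  assumes n: "2 \<le> n" and s: "2 \<le> s" and ij: "i < n" "j < n" "i \<noteq> j" and r: "1 \<le> r"
    and R: "1 \<le> R" "R \<le> n" "R \<le> s" "r \<le> d * R"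
    and q: "0 < q" "q < 1" "word_fraction \<kappa> n q" and e: "e = (2 * \<kappa> + 21) * d"
  shows "\<exists>\<A>. rounds \<A> \<le> 11 * r * nat \<lceil>log (real s) (real n)\<rceil> \<and>
    computes_norm_within n (n ^ (e + 10)) s r q i j R \<A>"
proof -
  obtain a b :: nat where ab: "0 < b" "b \<le> n ^ \<kappa>" "q = real a / real b"
    using q by (auto simp: word_fraction_def)
  have "real a < real b" using q(2) ab by simp
  then have "a + b \<le> 2 * n ^ \<kappa>" using ab by simp
  also have "\<dots> \<le> n * n ^ \<kappa>" using n by simp
  finally have "n * (a + b) \<le> n * (n * n ^ \<kappa>)" by (rule mult_left_mono) simp
  then have "int (n * (a + b)) \<le> int (n ^ (\<kappa> + 2))" by (simp only: of_nat_le_iff) simp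
  then have p: "int n * (int a + int b) \<le> int n ^ (\<kappa> + 2)" by simp
  have "(\<kappa> + 2) * (2 * r) + 3 \<le> (2 * \<kappa> + 21) * r" using r by (simp add: algebra_simps)
  also have "\<dots> \<le> e * R"
    unfolding e mult.assoc by (rule mult_left_mono[OF R(4)]) simp
  finally have exp: "(\<kappa> + 2) * (2 * r) + 3 \<le> e * R" .
  show ?thesis
  proof (rule computes_norm_by_residues[OF n s ij r R(1,2)])
    have "R \<le> 1 * s" using R by simp
    also have "\<dots> \<le> r * s" using r by (rule mult_right_mono) simp
    finally show "R \<le> r * s" .
    fix E E'
    have q': "q = of_int (int a) / of_int (int b)" using ab by simp
    show "shift_form n E q 1 i j (2 * r) = shift_form n E' q 1 i j (2 * r)"
      if "shift_form n E (int a) (int b) i j (2 * r) = shift_form n E' (int a) (int b) i j (2 * r)"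
      using shift_form_fraction[OF _ q', of n E i j "2 * r"] shift_form_fraction[OF _ q', of n E' i j "2 * r"]
        ab(1) that by simp
    have "2 * \<bar>shift_form n E (int a) (int b) i j (2 * r)\<bar> < int n ^ ((\<kappa> + 2) * (2 * r) + 3)"
      using n p by (intro abs_shift_form_less) auto
    also have "\<dots> \<le> int n ^ (e * R)" using n exp by (intro power_increasing) auto
    finally show "2 * \<bar>shift_form n E (int a) (int b) i j (2 * r)\<bar> < int n ^ (e * R)" .
  qed
qed

lemma computes_norm_real:
  fixes q :: real
  assumes n: "2 \<le> n" and s: "2 \<le> s" and ij: "i < n" "j < n" "i \<noteq> j" and r: "1 \<le> r"
    and R: "1 \<le> R" "r * R \<le> n" "R \<le> s" "r \<le> d * R" and e: "e = (2 * \<kappa> + 21) * d"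
  shows "\<exists>\<A>. rounds \<A> \<le> 11 * r * nat \<lceil>log (real s) (real n)\<rceil> \<and>
    computes_norm_within n (n ^ (e + 10)) s r q i j (r * R) \<A>"
proof -
  \<comment> \<open>Large enough to replace q: \<open>(2 * int n) ^ (2 * r)\<close> is at most
    \<open>int n ^ (4 * r)\<close>, and the remaining factor 4 is below
    \<open>int n ^ 3\<close>.\<close>
  define X where "X = int n ^ (4 * r + 3)"
  have X1: "1 \<le> X" using n by (simp add: X_def)
  have "int n * (X + 1) \<le> int n * (int n * X)"
  proof (rule mult_left_mono)
    have "2 * X \<le> int n * X" using n X1 by (intro mult_right_mono) auto
    then show "X + 1 \<le> int n * X" using X1 by linarith
  qed simp
  then have p: "int n * (X + 1) \<le> int n ^ (4 * r + 5)" 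
    by (simp add: X_def power_add numeral_eq_Suc algebra_simps)
  \<comment> \<open>The 21 in \<open>e\<close> is 8 + 10 + 3. The exponent is quadratic in r, which
    is why \<open>r * R\<close> residues are taken.\<close>
  have "(4 * r + 5) * (2 * r) + 3 \<le> 21 * (r * r)"
  proof -
    have "r \<le> r * r" "1 \<le> r * r" using r by auto
    moreover have "(4 * r + 5) * (2 * r) + 3 = 8 * (r * r) + 10 * r + 3" by (simp add: algebra_simps)
    ultimately show ?thesis by linarith
  qed
  also have "\<dots> \<le> (2 * \<kappa> + 21) * (r * (d * R))"
    using R(4) by (intro mult_mono) auto
  finally have exp: "(4 * r + 5) * (2 * r) + 3 \<le> e * (r * R)"
    by (simp add: e mult_ac)
  show ?thesis
  proof (rule computes_norm_by_residues[OF n s ij r])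
    show "1 \<le> r * R" "r * R \<le> n" "r * R \<le> r * s" using r R by auto
    fix E E'
    show "shift_form n E q 1 i j (2 * r) = shift_form n E' q 1 i j (2 * r)"
      if "shift_form n E X 1 i j (2 * r) = shift_form n E' X 1 i j (2 * r)"
    proof (rule shift_form_determined[OF _ that])
      have "2 * int n \<le> int n ^ 2" using n by (simp add: power2_eq_square)
      then have "(2 * int n) ^ (2 * r) \<le> (int n ^ 2) ^ (2 * r)" by (rule power_mono) simp
      also have "\<dots> = int n ^ (4 * r)" by (simp flip: power_mult)
      finally have "4 * (2 * int n) ^ (2 * r) \<le> 4 * int n ^ (4 * r)" by simp
      also have "\<dots> < 8 * int n ^ (4 * r)" using n by simp
      also have "\<dots> \<le> int n ^ 3 * int n ^ (4 * r)"
        using power_mono[of 2 "int n" 3] n by (intro mult_right_mono) auto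
      finally show "4 * (2 * int n) ^ (2 * r) < X" by (simp add: X_def power_add mult.commute)
    qed
    have "2 * \<bar>shift_form n E X 1 i j (2 * r)\<bar> < int n ^ ((4 * r + 5) * (2 * r) + 3)"
      using n p X1 by (intro abs_shift_form_less) auto
    also have "\<dots> \<le> int n ^ (e * (r * R))" using n exp by (intro power_increasing) auto
    finally show "2 * \<bar>shift_form n E X 1 i j (2 * r)\<bar> < int n ^ (e * (r * R))" .
  qed
qed

theorem theorem7:
  fixes K c :: real and \<kappa> :: nat
  assumes "K > 0" and "c > 0"
  shows "\<exists>W \<ge> 2. \<exists>C > 0. \<exists>n\<^sub>0. \<forall>n \<ge> n\<^sub>0. \<forall>s r :: nat.
    real s \<ge> c * log 2 (real n) \<longrightarrow> real r \<le> K * log 2 (real n) \<longrightarrow>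
    (\<forall>q :: real. 0 < q \<and> q < 1 \<longrightarrow> (\<forall>i < n. \<forall>j < n. \<exists>\<A> :: mpc_algorithm.
       real (rounds \<A>) \<le> C * real r * real_of_int \<lceil>log (real s) (real n)\<rceil> \<and>
       (\<forall>E input. graph_on n E \<longrightarrow> edge_distribution n E (n ^ W) s input \<longrightarrow>
          mpc_computes (n ^ W) s \<A> input
            (euclidean_norm (row (shifted_adjacency n E q ^\<^sub>m r) i
                           - row (shifted_adjacency n E q ^\<^sub>m r) j)) \<and>
          (word_fraction \<kappa> n q \<longrightarrow> length (mpc_output \<A> (n ^ W) input) \<le> s))))"
proof -
  \<comment> \<open>Chosen for \<open>r \<le> d * R\<close> below: r is at most K log n, and
    \<open>R\<close> at least half of c log n.\<close>
  define d where "d = nat \<lceil>2 * K / c\<rceil>"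
  define e where "e = (2 * \<kappa> + 21) * d"
  \<comment> \<open>These give, in turn, \<open>1 \<le> R\<close> and \<open>2 \<le> s\<close>, then
    \<open>R \<le> n\<close>, then \<open>r * R \<le> n\<close>.\<close>
  have "eventually (\<lambda>n. 2 \<le> c * log 2 (real n) \<and> c * log 2 (real n) \<le> real n \<and>
      K * log 2 (real n) * (c * log 2 (real n)) \<le> real n \<and> 2 \<le> n) at_top"
    using assms by (intro eventually_conj; real_asymp)
  then obtain n\<^sub>0 where n0: "\<And>n. n \<ge> n\<^sub>0 \<Longrightarrow> 2 \<le> c * log 2 (real n) \<and> c * log 2 (real n) \<le> real n \<and>
      K * log 2 (real n) * (c * log 2 (real n)) \<le> real n \<and> 2 \<le> n"
    by (auto simp: eventually_at_top_linorder)
  have "\<exists>\<A>. real (rounds \<A>) \<le> 11 * real r * real_of_int \<lceil>log (real s) (real n)\<rceil> \<and>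
      (\<forall>E input. graph_on n E \<longrightarrow> edge_distribution n E (n ^ (e + 10)) s input \<longrightarrow>
          mpc_computes (n ^ (e + 10)) s \<A> input
            (euclidean_norm (row (shifted_adjacency n E q ^\<^sub>m r) i
                           - row (shifted_adjacency n E q ^\<^sub>m r) j)) \<and>
          (word_fraction \<kappa> n q \<longrightarrow> length (mpc_output \<A> (n ^ (e + 10)) input) \<le> s))"
    if n: "n \<ge> n\<^sub>0" and s: "real s \<ge> c * log 2 (real n)" and r: "real r \<le> K * log 2 (real n)"
      and q: "0 < q" "q < 1" and ij: "i < n" "j < n" for n s r i j :: nat and q :: real
  proof -
    define L where "L = log 2 (real n)"
    \<comment> \<open>The lower bound on the memory makes this at most \<open>s\<close>.\<close>
    define R where "R = nat \<lfloor>c * L\<rfloor>"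
    have L: "2 \<le> c * L" "c * L \<le> real n" "K * L * (c * L) \<le> real n" and n2: "2 \<le> n"
      using n0[OF n] by (auto simp: L_def)
    have "real_of_int \<lfloor>c * L\<rfloor> \<le> c * L" "c * L - 1 < real_of_int \<lfloor>c * L\<rfloor>" by linarith+
    then have RL: "real R \<le> c * L" "c * L / 2 \<le> real R" using L(1) unfolding R_def by linarith+
    have s2: "2 \<le> s" using s L(1) by (simp add: L_def)
    have R1: "1 \<le> R" using RL L(1) by linarith
    have Rs: "R \<le> s" using RL s by (simp add: L_def)
    have Rn: "R \<le> n" using RL L by linarith
    have "real r * real R \<le> K * L * (c * L)"
      using r RL by (intro mult_mono) (auto simp: L_def intro: order_trans[of _ "real r"])
    then have rR: "r * R \<le> n" using L(3) by (simp flip: of_nat_mult)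
    have "real r \<le> 2 * K / c * (c * L / 2)" using r assms by (simp add: L_def)
    also have "\<dots> \<le> real d * real R"
    proof (rule mult_mono)
      show "2 * K / c \<le> real d" unfolding d_def by linarith
    qed (use RL L in auto)
    finally have rd: "r \<le> d * R" by (simp flip: of_nat_mult)
    have "0 < log (real s) (real n)" using s2 n2 by simp
    then have ceil: "real (nat \<lceil>log (real s) (real n)\<rceil>) = real_of_int \<lceil>log (real s) (real n)\<rceil>"
      by (simp add: less_imp_le)
    have "\<exists>\<A> m. rounds \<A> \<le> 11 * r * nat \<lceil>log (real s) (real n)\<rceil> \<and>
      computes_norm_within n (n ^ (e + 10)) s r q i j m \<A> \<and> (word_fraction \<kappa> n q \<longrightarrow> m \<le> s)"
    proof (cases "r = 0 \<or> i = j")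
      case True
      then show ?thesis using computes_norm_trivial[OF ij True] by (metis le0)
    next
      case False
      then have r1: "1 \<le> r" and ne: "i \<noteq> j" by auto
      show ?thesis
      proof (cases "word_fraction \<kappa> n q")
        case True
        then show ?thesis
          using computes_norm_fraction[OF n2 s2 ij ne r1 R1 Rn Rs rd q True e_def] Rs by blast
      next
        case False
        then show ?thesis
          using computes_norm_real[OF n2 s2 ij ne r1 R1 rR Rs rd e_def, of q] by blast
      qed
    qed
    then obtain \<A> m where A: "rounds \<A> \<le> 11 * r * nat \<lceil>log (real s) (real n)\<rceil>"
      "computes_norm_within n (n ^ (e + 10)) s r q i j m \<A>" "word_fraction \<kappa> n q \<longrightarrow> m \<le> s"
      by blast
    have "real (rounds \<A>) \<le> real (11 * r * nat \<lceil>log (real s) (real n)\<rceil>)"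
      using A(1) by (simp only: of_nat_le_iff)
    then have "real (rounds \<A>) \<le> 11 * real r * real_of_int \<lceil>log (real s) (real n)\<rceil>"
      by (simp only: of_nat_mult of_nat_numeral ceil)
    then show ?thesis
      using A(2,3) unfolding computes_norm_within_def by (intro exI[of _ \<A>]) (meson order_trans)
  qed
  then show ?thesis
    by (intro exI[of _ "e + 10"] conjI exI[of _ 11] exI[of _ n\<^sub>0] allI impI) auto
qed

end
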